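(* Let $m\le d$ and let $C\in\mathcal{U}_{m,3}$ be the core tensor of a generic dictionary, i.e. a generic real point of the universal variety $\mathcal{U}_{m,3}$. Given $X\in\mathbb{R}^{d\times m}$ of rank $m$, the only real solution $Y\in\mathbb{R}^{d\times m}$ to $[\![C;X,X,X]\!]=[\![C;Y,Y,Y]\!]$ is $Y=X$.
   Context: For $C=(c_{ijk})\in\mathbb{R}^{m\times m\times m}$ and $X=(x_{ij})\in\mathbb{R}^{d\times m}$, $[\![C;X,X,X]\!]\in\mathbb{R}^{d\times d\times d}$ has entries $[\![C;X,X,X]\!]_{\alpha\beta\gamma}=\sum_{i,j,k=1}^m c_{ijk}\,x_{\alpha i}x_{\beta j}x_{\gamma k}$. The universal variety $\mathcal{U}_{m,3}\subset(\mathbb{C}^m)^{\otimes 3}$ is the (irreducible, affine) variety of all third order signature tensors of paths $\psi:[0,1]\to\mathbb{C}^m$ (equivalently, of core tensors of dictionaries of size $m$), where the third order signature has entries $c_{ijk}=\int_0^1\left(\int_0^{t_3}\left(\int_0^{t_2}\mathrm{d}\psi_i(t_1)\right)\mathrm{d}\psi_j(t_2)\right)\mathrm{d}\psi_k(t_3)$. Concretely, it is parametrized (up to Zariski closure) by the tensors $$C=\tfrac16 P^{\otimes 3}+\tfrac12\,(P\otimes Q+Q\otimes P)+L,$$ where $P\in\mathbb{C}^m$ is a vector, $Q\in\mathbb{C}^m\otimes\mathbb{C}^m$ is a skew-symmetric matrix, and $L$ lies in the linear span in $(\mathbb{C}^m)^{\otimes 3}$ of all iterated commutators $[a,[b,c]]$,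 $a,b,c\in\mathbb{C}^m$, computed in the tensor algebra. "Generic" means: there is a proper Zariski closed subset of $\mathcal{U}_{m,3}$ such that the assertion holds for all real points $C$ of $\mathcal{U}_{m,3}$ outside it. *)

theory Defs
  imports "HOL-Analysis.Analysis"
begin

text \<open>
  A third order tensor over an index type is a nested vector with entry
  \<open>T $ i $ j $ k\<close> at position \<open>(i, j, k)\<close>.  A \<open>d \<times> m\<close> matrix \<open>X\<close> has type
  \<open>real ^ 'm ^ 'd\<close> and entries \<open>X $ \<alpha> $ i\<close>.
\<close>

type_synonym ('a, 'n) tensor3 = "'a ^ 'n ^ 'n ^ 'n"

definition multilinear_mult ::
  "(real, 'm::finite) tensor3 \<Rightarrow> real ^ 'm ^ 'd \<Rightarrow> real ^ 'm ^ 'd \<Rightarrow> real ^ 'm ^ 'd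
     \<Rightarrow> (real, 'd::finite) tensor3"
  (\<open>\<lbrakk>_; _, _, _\<rbrakk>\<close>)
  where "\<lbrakk>C; X, Y, Z\<rbrakk> = (\<chi> \<alpha> \<beta> \<gamma>.
    \<Sum>i\<in>UNIV. \<Sum>j\<in>UNIV. \<Sum>k\<in>UNIV. C $ i $ j $ k * X $ \<alpha> $ i * Y $ \<beta> $ j * Z $ \<gamma> $ k)"

definition complex_tensor :: "(real, 'm::finite) tensor3 \<Rightarrow> (complex, 'm) tensor3"
  where "complex_tensor C = (\<chi> i j k. complex_of_real (C $ i $ j $ k))"

text \<open>
  Complex polynomial functions in the tensor entries.  The library predicate
  \<open>real_polynomial_function\<close> cannot be used: it is built from real-linear maps, so its
  zero sets are the real algebraic sets.
\<close>

inductive tensor_polynomial :: "((complex, 'm::finite) tensor3 \<Rightarrow> complex) \<Rightarrow> bool"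
  where
    const: "tensor_polynomial (\<lambda>T. c)"
  | entry: "tensor_polynomial (\<lambda>T. T $ i $ j $ k)"
  | add: "tensor_polynomial f \<Longrightarrow> tensor_polynomial g \<Longrightarrow> tensor_polynomial (\<lambda>T. f T + g T)"
  | mult: "tensor_polynomial f \<Longrightarrow> tensor_polynomial g \<Longrightarrow> tensor_polynomial (\<lambda>T. f T * g T)"

definition zariski_closed :: "(complex, 'm::finite) tensor3 set \<Rightarrow> bool"
  where "zariski_closed Z \<longleftrightarrow>
    (\<exists>F. (\<forall>f\<in>F. tensor_polynomial f) \<and> Z = {T. \<forall>f\<in>F. f T = 0})"

text \<open>
  Paths are piecewise continuously differentiable of finite length.  The second conjunct is
  not redundant: \<open>piecewise_C1_differentiable_on\<close> places no bound on the derivative near the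
  exceptional points, and the iterated integrals below could then fail to exist.
\<close>

definition signature_path :: "(real \<Rightarrow> complex ^ 'm::finite) \<Rightarrow> bool"
  where "signature_path \<psi> \<longleftrightarrow>
    \<psi> piecewise_C1_differentiable_on {0..1} \<and>
    (\<lambda>t. vector_derivative \<psi> (at t)) absolutely_integrable_on {0..1}"

definition signature3 :: "(real \<Rightarrow> complex ^ 'm::finite) \<Rightarrow> (complex, 'm) tensor3"
  where "signature3 \<psi> = (\<chi> i j k.
    integral {0..1} (\<lambda>t\<^sub>3.
      integral {0..t\<^sub>3} (\<lambda>t\<^sub>2.
        integral {0..t\<^sub>2} (\<lambda>t\<^sub>1. vector_derivative \<psi> (at t\<^sub>1) $ i)
          * vector_derivative \<psi> (at t\<^sub>2) $ j)
        * vector_derivative \<psi> (at t\<^sub>3) $ k))"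

definition universal_variety :: "(complex, 'm::finite) tensor3 set"
  where "universal_variety = zariski_closed hull (signature3 ` {\<psi>. signature_path \<psi>})"

end

(*
  On signatures, and hence on the universal variety, the shuffle identities hold:
  P \<otimes> P \<otimes> P is the sum of all six slot permutations of C, and P \<otimes> M is the sum of
  C_ijk + C_jik + C_jki, where P and M are the first and second level signatures.  So a real
  matrix g with [C; g, g, g] = C satisfies g P = P (real cubes are injective) and g M g^T = M.

  From P, M and C further g-invariant objects are built by contraction with M^(-1) (replaced by
  the adjugate, with powers of det M restoring homogeneity, so that all is polynomial in C): the vector w with entries
  sum_ij C_ijk (M^(-1))_ji + P_k / 6, the covector phi = M^(-T) w, the form
  G_ik = sum_j C_ijk phi_j - M_ik / 3, and the endomorphism G M^(-1), which commutes with g.  If P is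
  a cyclic vector of this endomorphism, then g fixes a basis.  This is a Zariski open condition
  on C, and it holds for the axis path e_1, ..., e_m: there M is upper triangular, phi is the
  all-ones covector, and G is strictly upper triangular with nonzero superdiagonal.
*)

theory Submission
  imports Defs
begin

section \<open>Shuffle identities\<close>

definition primitive :: "(real \<Rightarrow> complex) \<Rightarrow> real \<Rightarrow> complex"
  where "primitive f t = integral {0..t} f"

text \<open>A class of integrands closed under passing from \<open>f\<close> and \<open>g\<close> to
  \<open>primitive f * g\<close>, with one fixed exceptional set: absolute integrability survives
  multiplication by a bounded primitive, and continuity off a finite \<open>S\<close> gives
  primitives the expected derivative there.\<close>

definition integrable_off :: "real set \<Rightarrow> (real \<Rightarrow> complex) \<Rightarrow> bool"
  where "integrable_off S f \<longleftrightarrow> f absolutely_integrable_on {0..1} \<and> continuous_on ({0..1} - S) f"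

lemma primitive_0 [simp]: "primitive f 0 = 0"
  by (simp add: primitive_def)

lemma primitive_continuous:
  assumes "integrable_off S f"
  shows "continuous_on {0..1} (primitive f)"
  using assms unfolding primitive_def integrable_off_def
  by (auto intro: indefinite_integral_continuous_1 simp: absolutely_integrable_on_def)

lemma primitive_derivative:
  assumes f: "integrable_off S f" and "finite S" and x: "x \<in> {0<..<1} - S"
  shows "(primitive f has_vector_derivative f x) (at x)"
proof -
  have "(primitive f has_vector_derivative f x) (at x within ({0..1} - S))"
    unfolding primitive_def
    using f x \<open>finite S\<close>
    by (intro integral_has_vector_derivative_continuous_at)
       (auto simp: integrable_off_def absolutely_integrable_on_def continuous_on_eq_continuous_within)
  moreover have "open ({0<..<1} - S)"
    by (simp add: \<open>finite S\<close> finite_imp_closed open_Diff)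
  then have "at x within ({0..1} - S) = at x"
    using x by (intro at_within_open_subset[of x "{0<..<1} - S"]) auto
  ultimately show ?thesis by simp
qed

lemma primitive_mult_integrable:
  assumes f: "integrable_off S f" and g: "integrable_off S g"
  shows "integrable_off S (\<lambda>t. primitive f t * g t)"
proof -
  have c: "continuous_on {0..1} (primitive f)" using f by (rule primitive_continuous)
  have "(\<lambda>t. primitive f t * g t) absolutely_integrable_on {0..1}"
  proof (rule absolutely_integrable_bounded_measurable_product[OF bilinear_times])
    show "primitive f \<in> borel_measurable (lebesgue_on {0..1})"
      using c by (rule continuous_imp_measurable_on_sets_lebesgue) simp
    show "bounded (primitive f ` {0..1})"
      using c by (intro compact_imp_bounded compact_continuous_image) auto
  qed (use g in \<open>auto simp: integrable_off_def\<close>)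
  moreover have "continuous_on ({0..1} - S) (\<lambda>t. primitive f t * g t)"
    using g continuous_on_subset[OF c] by (auto simp: integrable_off_def intro!: continuous_intros)
  ultimately show ?thesis by (simp add: integrable_off_def)
qed

lemma primitive_eqI:
  assumes "finite S" "continuous_on {0..1} E" "E 0 = 0"
    and "\<And>x. x \<in> {0<..<1} - S \<Longrightarrow> (E has_vector_derivative f x) (at x)"
    and t: "t \<in> {0..1}"
  shows "primitive f t = E t"
proof -
  have "(f has_integral E t - E 0) {0..t}"
    using assms t
    by (intro fundamental_theorem_of_calculus_interior_strong[of S])
       (auto intro: continuous_on_subset)
  then show ?thesis using \<open>E 0 = 0\<close> by (simp add: primitive_def integral_unique)
qed

lemma primitive_add:
  assumes "integrable_off S f" "integrable_off S g" and t: "t \<in> {0..1}"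
  shows "primitive (\<lambda>t. f t + g t) t = primitive f t + primitive g t"
proof -
  have "f integrable_on {0..t}" "g integrable_on {0..t}"
    using assms integrable_on_subinterval[of _ "{0..1}" 0 t]
    by (auto simp: integrable_off_def absolutely_integrable_on_def)
  then show ?thesis by (simp add: primitive_def integral_add)
qed

lemma primitive_cong:
  assumes "\<And>x. x \<in> {0..1} \<Longrightarrow> f x = g x" and "t \<in> {0..1}"
  shows "primitive f t = primitive g t"
  unfolding primitive_def using assms by (intro integral_cong) auto

text \<open>Integration by parts: the product splits according to which of the two integration
  variables is the later one.\<close>

lemma primitive_mult_primitive:
  assumes f: "integrable_off S f" and g: "integrable_off S g" and S: "finite S" and t: "t \<in> {0..1}"
  shows "primitive f t * primitive g t
    = primitive (\<lambda>t. primitive f t * g t) t + primitive (\<lambda>t. primitive g t * f t) t"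
proof -
  have "primitive (\<lambda>t. primitive f t * g t + primitive g t * f t) t = primitive f t * primitive g t"
    using S
  proof (rule primitive_eqI)
    show "continuous_on {0..1} (\<lambda>t. primitive f t * primitive g t)"
      using f g by (intro continuous_intros primitive_continuous)
    show "((\<lambda>t. primitive f t * primitive g t) has_vector_derivative
        primitive f x * g x + primitive g x * f x) (at x)" if "x \<in> {0<..<1} - S" for x
      using has_vector_derivative_mult[OF primitive_derivative[OF f S that] primitive_derivative[OF g S that]]
      by (simp add: mult.commute)
  qed (use t in auto)
  then show ?thesis
    using primitive_add[OF primitive_mult_integrable[OF f g] primitive_mult_integrable[OF g f] t] by simp
qed

section \<open>Shuffle relations between the first three signature levels\<close>

definition shuffle12 :: "('a::ring_1, 'm::finite) tensor3 \<Rightarrow> 'm \<Rightarrow> 'm \<Rightarrow> 'm \<Rightarrow> 'a"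
  where "shuffle12 C i j k = C $ i $ j $ k + C $ j $ i $ k + C $ j $ k $ i"

text \<open>The first summand collects the orderings with j before k, the second those with k before
  j.\<close>

definition shuffle111 :: "('a::ring_1, 'm::finite) tensor3 \<Rightarrow> 'm \<Rightarrow> 'm \<Rightarrow> 'm \<Rightarrow> 'a"
  where "shuffle111 C i j k = shuffle12 C i j k + shuffle12 C i k j"

definition velocity :: "(real \<Rightarrow> complex ^ 'm::finite) \<Rightarrow> 'm \<Rightarrow> real \<Rightarrow> complex"
  where "velocity \<psi> i t = vector_derivative \<psi> (at t) $ i"

definition signature1 :: "(real \<Rightarrow> complex ^ 'm::finite) \<Rightarrow> 'm \<Rightarrow> complex"
  where "signature1 \<psi> i = primitive (velocity \<psi> i) 1"

definition signature2 :: "(real \<Rightarrow> complex ^ 'm::finite) \<Rightarrow> 'm \<Rightarrow> 'm \<Rightarrow> complex"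
  where "signature2 \<psi> i j = primitive (\<lambda>t. primitive (velocity \<psi> i) t * velocity \<psi> j t) 1"

lemma signature3_entry:
  "signature3 \<psi> $ i $ j $ k =
    primitive (\<lambda>t. primitive (\<lambda>t. primitive (velocity \<psi> i) t * velocity \<psi> j t) t * velocity \<psi> k t) 1"
  by (simp add: signature3_def primitive_def velocity_def[abs_def])

text \<open>All coordinates share one exceptional set, so iterated integrals of mixed letters stay
  in one class.\<close>

lemma velocity_integrable:
  assumes "signature_path \<psi>"
  obtains S where "finite S" "\<And>i. integrable_off S (velocity \<psi> i)"
proof -
  obtain S where S: "finite S" "\<psi> C1_differentiable_on ({0..1} - S)"
    using assms unfolding signature_path_def piecewise_C1_differentiable_on_def by blast
  have "integrable_off S (velocity \<psi> i)" for i
  proof -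
    have "continuous_on ({0..1} - S) (\<lambda>t. vector_derivative \<psi> (at t))"
      using S C1_differentiable_on_eq by blast
    moreover have "(\<lambda>x. x $ i) \<circ> (\<lambda>t. vector_derivative \<psi> (at t)) absolutely_integrable_on {0..1}"
      using assms unfolding signature_path_def
      by (intro absolutely_integrable_linear bounded_linear_vec_nth) auto
    ultimately show ?thesis
      unfolding integrable_off_def velocity_def by (auto simp: o_def intro!: continuous_intros)
  qed
  with S show ?thesis using that by blast
qed

text \<open>Integration by parts separates the term in which letter i comes last. In the remaining
  term k comes last, and the two-letter identity up to time t decides whether i precedes or follows
  j.\<close>

lemma shuffle12_signature3:
  assumes "signature_path \<psi>"
  shows "shuffle12 (signature3 \<psi>) i j k = signature1 \<psi> i * signature2 \<psi> j k"
proof -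
  obtain S where S: "finite S" and v: "\<And>i. integrable_off S (velocity \<psi> i)"
    using velocity_integrable[OF assms] by metis
  define J2 where "J2 i j t = primitive (velocity \<psi> i) t * velocity \<psi> j t" for i j t
  define J3 where "J3 i j k t = primitive (J2 i j) t * velocity \<psi> k t" for i j k t
  have J2: "integrable_off S (J2 i j)" for i j
    unfolding J2_def by (intro primitive_mult_integrable v)
  have J3: "integrable_off S (J3 i j k)" for i j k
    unfolding J3_def by (intro primitive_mult_integrable v J2)
  have sum: "primitive (velocity \<psi> i) t * J2 j k t = J3 i j k t + J3 j i k t" if "t \<in> {0..1}" for t
  proof -
    have "primitive (velocity \<psi> i) t * primitive (velocity \<psi> j) t
        = primitive (J2 i j) t + primitive (J2 j i) t"
      unfolding J2_def[abs_def] by (rule primitive_mult_primitive[OF v v S that])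
    then show ?thesis
      unfolding J2_def[of j k] J3_def by (metis distrib_right mult.assoc)
  qed
  have "primitive (velocity \<psi> i) 1 * primitive (J2 j k) 1
      = primitive (\<lambda>t. primitive (velocity \<psi> i) t * J2 j k t) 1 + primitive (J3 j k i) 1"
    using primitive_mult_primitive[OF v[of i] J2[of j k] S, of 1] by (simp add: J3_def[abs_def])
  also have "primitive (\<lambda>t. primitive (velocity \<psi> i) t * J2 j k t) 1
      = primitive (\<lambda>t. J3 i j k t + J3 j i k t) 1"
    by (intro primitive_cong sum) auto
  also have "\<dots> = primitive (J3 i j k) 1 + primitive (J3 j i k) 1"
    by (intro primitive_add[OF J3 J3]) auto
  finally show ?thesis
    by (simp add: shuffle12_def signature3_entry signature1_def signature2_def J2_def[abs_def] J3_def[abs_def])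
qed

lemma shuffle11_signature:
  assumes "signature_path \<psi>"
  shows "signature2 \<psi> i j + signature2 \<psi> j i = signature1 \<psi> i * signature1 \<psi> j"
proof -
  obtain S where "finite S" and "\<And>i. integrable_off S (velocity \<psi> i)"
    using velocity_integrable[OF assms] by metis
  then show ?thesis
    using primitive_mult_primitive[of S "velocity \<psi> i" "velocity \<psi> j" 1]
    by (simp add: signature1_def signature2_def)
qed

lemma shuffle111_signature3:
  assumes "signature_path \<psi>"
  shows "shuffle111 (signature3 \<psi>) i j k = signature1 \<psi> i * signature1 \<psi> j * signature1 \<psi> k"
  by (simp add: shuffle111_def shuffle12_signature3[OF assms] mult.assoc shuffle11_signature[OF assms]
      flip: distrib_left)

section \<open>Invariants of a stabilizing matrix\<close>

text \<open>Column \<open>k\<close> is replaced by the \<open>l\<close>-th unit vector, as in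
  Cramer's rule. This is det A times the inverse, written without division, so the entries are
  polynomial in those of \<open>A\<close>.\<close>

definition adjugate :: "'a::field ^ 'n ^ 'n \<Rightarrow> 'a ^ 'n ^ 'n"
  where "adjugate A = (\<chi> k l. det (\<chi> i j. if j = k then (if i = l then 1 else 0) else A $ i $ j))"

lemma mat_matrix_mult: "mat d ** A = (\<chi> i j. d * A $ i $ j)" for A :: "'a::comm_ring_1 ^ 'n ^ 'm"
  by (simp add: vec_eq_iff matrix_matrix_mult_def mat_def if_distrib[of "\<lambda>x. x * _"] cong: if_cong)

lemma matrix_mult_mat: "A ** mat d = (\<chi> i j. d * A $ i $ j)" for A :: "'a::comm_ring_1 ^ 'n ^ 'm"
  by (simp add: vec_eq_iff matrix_matrix_mult_def mat_def if_distrib[of "\<lambda>x. _ * x"] mult.commute cong: if_cong)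

lemma matrix_mult_adjugate:
  fixes A :: "'a::field ^ 'n ^ 'n"
  assumes d: "det A \<noteq> 0"
  shows "A ** adjugate A = mat (det A)"
proof -
  have col: "A *v (\<chi> k. adjugate A $ k $ l / det A) = (\<chi> i. if i = l then 1 else 0)" for l
    unfolding cramer[OF d] adjugate_def
    by (simp cong: if_cong)
  have "(\<Sum>k\<in>UNIV. A $ i $ k * adjugate A $ k $ l) = (if i = l then det A else 0)" for i l
  proof -
    have "(\<Sum>k\<in>UNIV. A $ i $ k * adjugate A $ k $ l) / det A = (if i = l then 1 else 0)"
      using col[of l] by (simp add: vec_eq_iff matrix_vector_mult_def sum_divide_distrib)
    then show ?thesis using d by (auto simp: field_simps split: if_splits)
  qed
  then show ?thesis by (simp add: vec_eq_iff matrix_matrix_mult_def mat_def)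
qed

lemma mat_times_mat_1: "mat d ** mat e = (mat (d * e) :: 'a::comm_ring_1 ^ 'n ^ 'n)"
  unfolding mat_matrix_mult by (auto simp: vec_eq_iff mat_def)

text \<open>Scaled by 1/d, \<open>B\<close> is a right inverse of the square matrix \<open>A\<close>
  and hence a left inverse.\<close>

lemma matrix_mult_eq_mat_commute:
  fixes A B :: "'a::field ^ 'n ^ 'n"
  assumes AB: "A ** B = mat d" and d: "d \<noteq> 0"
  shows "B ** A = mat d"
proof -
  have "A ** (B ** mat (1 / d)) = mat 1"
    using d by (simp add: matrix_mul_assoc AB mat_times_mat_1)
  then have "B ** mat (1 / d) ** A = mat 1" by (simp add: matrix_left_right_inverse)
  then have "mat d ** (B ** mat (1 / d) ** A) = mat d" by simp
  moreover have "mat d ** B ** mat (1 / d) = B"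
    using d by (simp add: matrix_mult_mat mat_matrix_mult vec_eq_iff)
  ultimately show ?thesis by (simp add: matrix_mul_assoc)
qed

lemma congruence_entry:
  fixes A :: "'a::comm_ring_1 ^ 'n ^ 'm"
  shows "(A ** B ** transpose A) $ \<alpha> $ \<beta> = (\<Sum>i\<in>UNIV. \<Sum>j\<in>UNIV. B $ i $ j * A $ \<alpha> $ i * A $ \<beta> $ j)"
proof -
  have "(A ** B ** transpose A) $ \<alpha> $ \<beta> = (\<Sum>j\<in>UNIV. \<Sum>i\<in>UNIV. B $ i $ j * A $ \<alpha> $ i * A $ \<beta> $ j)"
    by (simp add: matrix_matrix_mult_def transpose_def sum_distrib_left mult_ac)
  also have "\<dots> = (\<Sum>i\<in>UNIV. \<Sum>j\<in>UNIV. B $ i $ j * A $ \<alpha> $ i * A $ \<beta> $ j)"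
    by (rule sum.swap)
  finally show ?thesis .
qed

text \<open>Up to the factor det N this is the inverse of the relation \<open>g\<close>. The role of
  the inverse of \<open>g\<close> is played by \<open>N ** transpose g ** adjugate N\<close>, again
  up to det N.\<close>

lemma adjugate_invariant:
  fixes g N :: "'a::field ^ 'n ^ 'n"
  assumes g: "g ** N ** transpose g = N" and d: "det N \<noteq> 0"
  shows "transpose g ** adjugate N ** g = adjugate N"
proof -
  let ?W = "adjugate N"
  have W: "N ** ?W = mat (det N)" "?W ** N = mat (det N)"
    using matrix_mult_adjugate[OF d] matrix_mult_eq_mat_commute d by blast+
  have "g ** (N ** transpose g ** ?W) = mat (det N)"
    using g W by (simp add: matrix_mul_assoc)
  then have "N ** transpose g ** ?W ** g = mat (det N)"
    using d by (rule matrix_mult_eq_mat_commute)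
  then have "?W ** (N ** transpose g ** ?W ** g) = ?W ** mat (det N)" by simp
  then have "mat (det N) ** (transpose g ** ?W ** g) = ?W ** mat (det N)"
    using W by (simp add: matrix_mul_assoc)
  then show ?thesis using d by (simp add: mat_matrix_mult matrix_mult_mat vec_eq_iff)
qed

section \<open>Tensors fixed by a matrix acting on all slots\<close>

definition stabilizes :: "'a::field ^ 'n::finite ^ 'n \<Rightarrow> ('n \<Rightarrow> 'n \<Rightarrow> 'n \<Rightarrow> 'a) \<Rightarrow> bool"
  where "stabilizes g c \<longleftrightarrow> (\<forall>\<alpha> \<beta> \<gamma>.
    (\<Sum>i\<in>UNIV. \<Sum>j\<in>UNIV. \<Sum>k\<in>UNIV. c i j k * g $ \<alpha> $ i * g $ \<beta> $ j * g $ \<gamma> $ k) = c \<alpha> \<beta> \<gamma>)"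

lemma stabilizesD:
  "stabilizes g c \<Longrightarrow>
    (\<Sum>i\<in>UNIV. \<Sum>j\<in>UNIV. \<Sum>k\<in>UNIV. c i j k * g $ \<alpha> $ i * g $ \<beta> $ j * g $ \<gamma> $ k) = c \<alpha> \<beta> \<gamma>"
  by (simp add: stabilizes_def)

text \<open>The same matrix acts on every slot, so its action commutes with slot
  permutations.\<close>

lemma stabilizes_swap12:
  assumes "stabilizes g c" shows "stabilizes g (\<lambda>i j k. c j i k)"
  unfolding stabilizes_def
proof (intro allI)
  fix \<alpha> \<beta> \<gamma>
  have "(\<Sum>i\<in>UNIV. \<Sum>j\<in>UNIV. \<Sum>k\<in>UNIV. c j i k * g $ \<alpha> $ i * g $ \<beta> $ j * g $ \<gamma> $ k) =
    (\<Sum>j\<in>UNIV. \<Sum>i\<in>UNIV. \<Sum>k\<in>UNIV. c j i k * g $ \<beta> $ j * g $ \<alpha> $ i * g $ \<gamma> $ k)"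
    by (subst sum.swap) (simp only: mult_ac)
  also have "\<dots> = c \<beta> \<alpha> \<gamma>" using assms by (simp add: stabilizes_def)
  finally show "(\<Sum>i\<in>UNIV. \<Sum>j\<in>UNIV. \<Sum>k\<in>UNIV. c j i k * g $ \<alpha> $ i * g $ \<beta> $ j * g $ \<gamma> $ k) = c \<beta> \<alpha> \<gamma>" .
qed

lemma stabilizes_swap23:
  assumes "stabilizes g c" shows "stabilizes g (\<lambda>i j k. c i k j)"
  unfolding stabilizes_def
proof (intro allI)
  fix \<alpha> \<beta> \<gamma>
  have "(\<Sum>i\<in>UNIV. \<Sum>j\<in>UNIV. \<Sum>k\<in>UNIV. c i k j * g $ \<alpha> $ i * g $ \<beta> $ j * g $ \<gamma> $ k) =
    (\<Sum>i\<in>UNIV. \<Sum>k\<in>UNIV. \<Sum>j\<in>UNIV. c i k j * g $ \<alpha> $ i * g $ \<gamma> $ k * g $ \<beta> $ j)"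
    by (rule sum.cong[OF refl], subst sum.swap) (simp only: mult_ac)
  also have "\<dots> = c \<alpha> \<gamma> \<beta>" using assms by (simp add: stabilizes_def)
  finally show "(\<Sum>i\<in>UNIV. \<Sum>j\<in>UNIV. \<Sum>k\<in>UNIV. c i k j * g $ \<alpha> $ i * g $ \<beta> $ j * g $ \<gamma> $ k) = c \<alpha> \<gamma> \<beta>" .
qed

lemma stabilizes_add:
  "stabilizes g c \<Longrightarrow> stabilizes g d \<Longrightarrow> stabilizes g (\<lambda>i j k. c i j k + d i j k)"
  by (simp add: stabilizes_def distrib_right sum.distrib)

lemma stabilizes_scale:
  assumes "stabilizes g c" shows "stabilizes g (\<lambda>i j k. r * c i j k)"
  unfolding stabilizes_def
proof (intro allI)
  fix \<alpha> \<beta> \<gamma>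
  have "(\<Sum>i\<in>UNIV. \<Sum>j\<in>UNIV. \<Sum>k\<in>UNIV. r * c i j k * g $ \<alpha> $ i * g $ \<beta> $ j * g $ \<gamma> $ k)
    = r * (\<Sum>i\<in>UNIV. \<Sum>j\<in>UNIV. \<Sum>k\<in>UNIV. c i j k * g $ \<alpha> $ i * g $ \<beta> $ j * g $ \<gamma> $ k)"
    by (simp add: sum_distrib_left mult.assoc)
  then show "(\<Sum>i\<in>UNIV. \<Sum>j\<in>UNIV. \<Sum>k\<in>UNIV. r * c i j k * g $ \<alpha> $ i * g $ \<beta> $ j * g $ \<gamma> $ k)
    = r * c \<alpha> \<beta> \<gamma>"
    by (simp add: stabilizesD[OF assms])
qed

lemma stabilizes_shuffle12:
  assumes "stabilizes g (\<lambda>i j k. C $ i $ j $ k)"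
  shows "stabilizes g (shuffle12 C)"
proof -
  have 1: "stabilizes g (\<lambda>i j k. C $ j $ i $ k)"
    using stabilizes_swap12[OF assms] by simp
  have "stabilizes g (\<lambda>i j k. C $ j $ k $ i)"
    using stabilizes_swap12[OF stabilizes_swap23[OF assms]] by simp
  with 1 show ?thesis
    unfolding shuffle12_def[abs_def] by (intro stabilizes_add assms)
qed

lemma stabilizes_shuffle111:
  assumes "stabilizes g (\<lambda>i j k. C $ i $ j $ k)"
  shows "stabilizes g (shuffle111 C)"
  unfolding shuffle111_def[abs_def]
  by (rule stabilizes_add[OF stabilizes_shuffle12 stabilizes_swap23[OF stabilizes_shuffle12]]; rule assms)

text \<open>The action on a product tensor factors. The factors themselves are thereby fixed only up
  to reciprocal scalars; that ambiguity has to be removed separately.\<close>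

lemma stabilizes_vec_form:
  assumes "stabilizes g (\<lambda>i j k. s $ i * N $ j $ k)"
  shows "(g *v s) $ \<alpha> * (g ** N ** transpose g) $ \<beta> $ \<gamma> = s $ \<alpha> * N $ \<beta> $ \<gamma>"
proof -
  have "(g *v s) $ \<alpha> * (g ** N ** transpose g) $ \<beta> $ \<gamma> =
    (\<Sum>i\<in>UNIV. g $ \<alpha> $ i * s $ i * (\<Sum>j\<in>UNIV. \<Sum>k\<in>UNIV. N $ j $ k * g $ \<beta> $ j * g $ \<gamma> $ k))"
    unfolding congruence_entry by (simp add: matrix_vector_mult_def sum_distrib_right)
  also have "\<dots> =
    (\<Sum>i\<in>UNIV. \<Sum>j\<in>UNIV. \<Sum>k\<in>UNIV. s $ i * N $ j $ k * g $ \<alpha> $ i * g $ \<beta> $ j * g $ \<gamma> $ k)"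
    by (simp add: sum_distrib_left mult_ac)
  finally show ?thesis using stabilizesD[OF assms] by simp
qed

definition trace_contract :: "('a::field, 'm::finite) tensor3 \<Rightarrow> 'a ^ 'm ^ 'm \<Rightarrow> 'a ^ 'm"
  where "trace_contract C W = (\<chi> k. trace ((\<chi> i j. C $ i $ j $ k) ** W))"

definition middle_contract :: "('a::field, 'm::finite) tensor3 \<Rightarrow> 'a ^ 'm \<Rightarrow> 'a ^ 'm ^ 'm"
  where "middle_contract C \<phi> = (\<chi> i k. \<Sum>j\<in>UNIV. C $ i $ j $ k * \<phi> $ j)"

text \<open>The first two slots are paired with a form that \<open>g\<close> preserves, so only the
  action on the third slot survives. Cyclicity of the trace moves both copies of \<open>g\<close>
  from the slices of \<open>C\<close> onto \<open>W\<close>.\<close>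

lemma trace_contract_invariant:
  assumes C: "stabilizes g (\<lambda>i j k. C $ i $ j $ k)" and W: "transpose g ** W ** g = W"
  shows "g *v trace_contract C W = trace_contract C W"
proof -
  let ?S = "\<lambda>k. (\<chi> i j. C $ i $ j $ k)"
  have slice: "(\<Sum>k\<in>UNIV. g $ \<gamma> $ k * (g ** ?S k ** transpose g) $ \<alpha> $ \<beta>) = C $ \<alpha> $ \<beta> $ \<gamma>" for \<alpha> \<beta> \<gamma>
  proof -
    have "(\<Sum>k\<in>UNIV. g $ \<gamma> $ k * (g ** ?S k ** transpose g) $ \<alpha> $ \<beta>)
      = (\<Sum>k\<in>UNIV. \<Sum>i\<in>UNIV. \<Sum>j\<in>UNIV. C $ i $ j $ k * g $ \<alpha> $ i * g $ \<beta> $ j * g $ \<gamma> $ k)"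
      unfolding congruence_entry by (simp add: sum_distrib_left mult_ac)
    also have "\<dots> = (\<Sum>i\<in>UNIV. \<Sum>k\<in>UNIV. \<Sum>j\<in>UNIV. C $ i $ j $ k * g $ \<alpha> $ i * g $ \<beta> $ j * g $ \<gamma> $ k)"
      by (rule sum.swap)
    also have "\<dots> = (\<Sum>i\<in>UNIV. \<Sum>j\<in>UNIV. \<Sum>k\<in>UNIV. C $ i $ j $ k * g $ \<alpha> $ i * g $ \<beta> $ j * g $ \<gamma> $ k)"
      by (rule sum.cong[OF refl], rule sum.swap)
    finally show ?thesis using stabilizesD[OF C] by simp
  qed
  have tr: "trace (?S k ** W) = trace (g ** ?S k ** transpose g ** W)" for k
  proof -
    have "trace (g ** ?S k ** transpose g ** W) = trace (g ** (?S k ** transpose g ** W))"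
      by (simp add: matrix_mul_assoc)
    also have "\<dots> = trace (?S k ** transpose g ** W ** g)" by (rule trace_mul_sym)
    also have "\<dots> = trace (?S k ** (transpose g ** W ** g))" by (simp add: matrix_mul_assoc)
    finally show ?thesis by (simp add: W)
  qed
  have "(g *v trace_contract C W) $ \<gamma> = trace (?S \<gamma> ** W)" for \<gamma>
  proof -
    have "(g *v trace_contract C W) $ \<gamma> = (\<Sum>k\<in>UNIV. g $ \<gamma> $ k * trace (g ** ?S k ** transpose g ** W))"
      by (simp add: matrix_vector_mult_def trace_contract_def flip: tr)
    also have "\<dots> = (\<Sum>k\<in>UNIV. \<Sum>\<alpha>\<in>UNIV. \<Sum>\<beta>\<in>UNIV.
        g $ \<gamma> $ k * (g ** ?S k ** transpose g) $ \<alpha> $ \<beta> * W $ \<beta> $ \<alpha>)"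
      unfolding trace_def matrix_matrix_mult_def[of "g ** ?S _ ** transpose g" W]
      by (simp add: sum_distrib_left mult.assoc)
    also have "\<dots> = (\<Sum>\<alpha>\<in>UNIV. \<Sum>k\<in>UNIV. \<Sum>\<beta>\<in>UNIV.
        g $ \<gamma> $ k * (g ** ?S k ** transpose g) $ \<alpha> $ \<beta> * W $ \<beta> $ \<alpha>)" by (rule sum.swap)
    also have "\<dots> = (\<Sum>\<alpha>\<in>UNIV. \<Sum>\<beta>\<in>UNIV. \<Sum>k\<in>UNIV.
        g $ \<gamma> $ k * (g ** ?S k ** transpose g) $ \<alpha> $ \<beta> * W $ \<beta> $ \<alpha>)"
      by (rule sum.cong[OF refl], rule sum.swap)
    also have "\<dots> = (\<Sum>\<alpha>\<in>UNIV. \<Sum>\<beta>\<in>UNIV. C $ \<alpha> $ \<beta> $ \<gamma> * W $ \<beta> $ \<alpha>)"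
      by (simp add: slice flip: sum_distrib_right)
    also have "\<dots> = trace (?S \<gamma> ** W)" by (simp add: trace_def matrix_matrix_mult_def)
    finally show ?thesis .
  qed
  then show ?thesis by (simp add: vec_eq_iff trace_contract_def)
qed

lemma middle_contract_invariant:
  assumes C: "stabilizes g (\<lambda>i j k. C $ i $ j $ k)" and \<phi>: "transpose g *v \<phi> = \<phi>"
  shows "g ** middle_contract C \<phi> ** transpose g = middle_contract C \<phi>"
proof -
  have \<phi>': "\<phi> $ j = (\<Sum>\<beta>\<in>UNIV. g $ \<beta> $ j * \<phi> $ \<beta>)" for j
    by (subst \<phi>[symmetric]) (simp add: matrix_vector_mult_def transpose_def)
  have "(g ** middle_contract C \<phi> ** transpose g) $ \<alpha> $ \<gamma> = middle_contract C \<phi> $ \<alpha> $ \<gamma>" for \<alpha> \<gamma>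
  proof -
    have "(g ** middle_contract C \<phi> ** transpose g) $ \<alpha> $ \<gamma>
      = (\<Sum>i\<in>UNIV. \<Sum>k\<in>UNIV. \<Sum>j\<in>UNIV. C $ i $ j $ k * g $ \<alpha> $ i * g $ \<gamma> $ k * \<phi> $ j)"
      unfolding congruence_entry by (simp add: middle_contract_def sum_distrib_left mult_ac)
    also have "\<dots> = (\<Sum>i\<in>UNIV. \<Sum>j\<in>UNIV. \<Sum>k\<in>UNIV. C $ i $ j $ k * g $ \<alpha> $ i * g $ \<gamma> $ k * \<phi> $ j)"
      by (rule sum.cong[OF refl], rule sum.swap)
    \<comment> \<open>The factor of \<open>g\<close> missing in the middle slot is drawn out of the
      fixed covector.\<close>
    also have "\<dots> = (\<Sum>i\<in>UNIV. \<Sum>j\<in>UNIV. \<Sum>k\<in>UNIV.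
        C $ i $ j $ k * g $ \<alpha> $ i * g $ \<gamma> $ k * (\<Sum>\<beta>\<in>UNIV. g $ \<beta> $ j * \<phi> $ \<beta>))"
      by (simp only: \<phi>'[symmetric])
    also have "\<dots> = (\<Sum>i\<in>UNIV. \<Sum>j\<in>UNIV. \<Sum>k\<in>UNIV. \<Sum>\<beta>\<in>UNIV.
        C $ i $ j $ k * g $ \<alpha> $ i * g $ \<beta> $ j * g $ \<gamma> $ k * \<phi> $ \<beta>)"
      by (simp add: sum_distrib_left mult_ac)
    also have "\<dots> = (\<Sum>i\<in>UNIV. \<Sum>j\<in>UNIV. \<Sum>\<beta>\<in>UNIV. \<Sum>k\<in>UNIV.
        C $ i $ j $ k * g $ \<alpha> $ i * g $ \<beta> $ j * g $ \<gamma> $ k * \<phi> $ \<beta>)"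
      by (rule sum.cong[OF refl], rule sum.cong[OF refl], rule sum.swap)
    also have "\<dots> = (\<Sum>i\<in>UNIV. \<Sum>\<beta>\<in>UNIV. \<Sum>j\<in>UNIV. \<Sum>k\<in>UNIV.
        C $ i $ j $ k * g $ \<alpha> $ i * g $ \<beta> $ j * g $ \<gamma> $ k * \<phi> $ \<beta>)"
      by (rule sum.cong[OF refl], rule sum.swap)
    also have "\<dots> = (\<Sum>\<beta>\<in>UNIV. \<Sum>i\<in>UNIV. \<Sum>j\<in>UNIV. \<Sum>k\<in>UNIV.
        C $ i $ j $ k * g $ \<alpha> $ i * g $ \<beta> $ j * g $ \<gamma> $ k * \<phi> $ \<beta>)"
      by (rule sum.swap)
    also have "\<dots> = (\<Sum>\<beta>\<in>UNIV. C $ \<alpha> $ \<beta> $ \<gamma> * \<phi> $ \<beta>)"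
      by (simp add: stabilizesD[OF C] flip: sum_distrib_right)
    finally show ?thesis by (simp add: middle_contract_def)
  qed
  then show ?thesis by (simp add: vec_eq_iff)
qed

section \<open>Polynomial invariants and the cyclic vector condition\<close>

text \<open>
  \<open>P\<close> and \<open>M\<close> are not polynomial in \<open>C\<close>; for a fixed index \<open>a\<close>, the multiples \<open>P\<^sub>a\<^sup>2 P\<close>
  (\<open>level1\<close>) and \<open>P\<^sub>a M\<close> (\<open>level2\<close>) are.
\<close>

definition level1 :: "'m \<Rightarrow> ('a::field, 'm::finite) tensor3 \<Rightarrow> 'a ^ 'm"
  where "level1 a C = (\<chi> i. shuffle111 C i a a)"

definition level2 :: "'m \<Rightarrow> ('a::field, 'm::finite) tensor3 \<Rightarrow> 'a ^ 'm ^ 'm"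
  where "level2 a C = (\<chi> j k. shuffle12 C a j k)"

text \<open>Write p = P_a and D = det (p M), with p and D nonzero. On a signature the first summand
  is D / p times the contraction of C with M^(-1), the second is D p^2 P / 6. A stabilizing g with g
  P = P fixes each summand separately, whatever the powers of p; for the axis path p = 1 and the sum
  is D w.\<close>

definition inv_vec :: "'m \<Rightarrow> ('a::field, 'm::finite) tensor3 \<Rightarrow> 'a ^ 'm"
  where "inv_vec a C = trace_contract C (adjugate (level2 a C)) + (det (level2 a C) / 6) *s level1 a C"

definition inv_covec :: "'m \<Rightarrow> ('a::field, 'm::finite) tensor3 \<Rightarrow> 'a ^ 'm"
  where "inv_covec a C = transpose (adjugate (level2 a C)) *v inv_vec a C"

text \<open>\<open>inv_covec\<close> carries the determinant twice, once from \<open>inv_vec\<close>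
  and once from the adjugate; the subtracted term is scaled to match.\<close>

definition inv_form :: "'m \<Rightarrow> ('a::field, 'm::finite) tensor3 \<Rightarrow> 'a ^ 'm ^ 'm"
  where "inv_form a C = middle_contract C (inv_covec a C) - mat (det (level2 a C) ^ 2 / 3) ** level2 a C"

definition inv_endo :: "'m \<Rightarrow> ('a::field, 'm::finite) tensor3 \<Rightarrow> 'a ^ 'm ^ 'm"
  where "inv_endo a C = inv_form a C ** adjugate (level2 a C)"

primrec krylov :: "'m \<Rightarrow> ('a::field, 'm::finite) tensor3 \<Rightarrow> nat \<Rightarrow> 'a ^ 'm"
  where
    "krylov a C 0 = level1 a C"
  | "krylov a C (Suc n) = inv_endo a C *v krylov a C n"

text \<open>With \<open>\<iota>\<close> a numbering of the index type by 0, ..., m - 1, the columns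
  are the first m Krylov vectors of \<open>level1\<close>.\<close>

definition krylov_matrix :: "('m \<Rightarrow> nat) \<Rightarrow> 'm \<Rightarrow> ('a::field, 'm::finite) tensor3 \<Rightarrow> 'a ^ 'm ^ 'm"
  where "krylov_matrix \<iota> a C = (\<chi> i j. krylov a C (\<iota> j) $ i)"

text \<open>Three conditions in one polynomial: P_a is nonzero (the first factor is its cube on
  signatures), the second level is invertible, and \<open>level1\<close> is a cyclic vector of
  \<open>inv_endo\<close>.\<close>

definition genericity :: "('m \<Rightarrow> nat) \<Rightarrow> 'm \<Rightarrow> ('a::field, 'm::finite) tensor3 \<Rightarrow> 'a"
  where "genericity \<iota> a C = level1 a C $ a * det (level2 a C) * det (krylov_matrix \<iota> a C)"

lemma matrix_add_rdistrib: "(A + B) ** C = A ** C + B ** C" for A B :: "'a::comm_ring_1 ^ 'n ^ 'm"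
  by (simp add: vec_eq_iff matrix_matrix_mult_def distrib_right sum.distrib)

lemma matrix_diff_rdistrib: "(A - B) ** C = A ** C - B ** C" for A B :: "'a::comm_ring_1 ^ 'n ^ 'm"
  by (simp add: vec_eq_iff matrix_matrix_mult_def left_diff_distrib sum_subtractf)

lemma matrix_diff_ldistrib: "A ** (B - C) = A ** B - A ** C" for A :: "'a::comm_ring_1 ^ 'n ^ 'm"
  by (simp add: vec_eq_iff matrix_matrix_mult_def right_diff_distrib sum_subtractf)

text \<open>Invariance passes through the equivariant constructions until \<open>g\<close> fixes
  every column of an invertible matrix. This part is valid over any field; fixedness of the two
  levels enters as a hypothesis because it is obtained from reality.\<close>

lemma stabilizer_trivial:
  fixes g :: "'a::field ^ 'm::finite ^ 'm"
  assumes C: "stabilizes g (\<lambda>i j k. C $ i $ j $ k)"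
    and s: "g *v level1 a C = level1 a C"
    and N: "g ** level2 a C ** transpose g = level2 a C"
    and gen: "genericity \<iota> a C \<noteq> 0"
  shows "g = mat 1"
proof -
  define W where "W = adjugate (level2 a C)"
  have d: "det (level2 a C) \<noteq> 0" and K: "det (krylov_matrix \<iota> a C) \<noteq> 0"
    using gen by (auto simp: genericity_def)
  have W: "transpose g ** W ** g = W"
    unfolding W_def using N d by (rule adjugate_invariant)
  have WT: "transpose g ** transpose W ** g = transpose W"
    using arg_cong[OF W, of transpose] by (simp add: matrix_transpose_mul matrix_mul_assoc)
  have w: "g *v inv_vec a C = inv_vec a C"
    unfolding inv_vec_def matrix_vector_right_distrib
    using trace_contract_invariant[OF C W] by (simp add: W_def s matrix_vector_mult_scaleR vec.scale)
  have "transpose g *v inv_covec a C = (transpose g ** transpose W ** g) *v inv_vec a C"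
    unfolding inv_covec_def W_def[symmetric] by (simp add: w flip: matrix_vector_mul_assoc)
  then have \<phi>: "transpose g *v inv_covec a C = inv_covec a C"
    by (simp add: WT) (simp add: inv_covec_def W_def)
  have "g ** (mat r ** A) ** transpose g = mat r ** (g ** A ** transpose g)" for r and A :: "'a ^ 'm ^ 'm"
    by (simp add: vec_eq_iff congruence_entry mat_matrix_mult sum_distrib_left mult.assoc)
  then have G: "g ** inv_form a C ** transpose g = inv_form a C"
    unfolding inv_form_def matrix_diff_ldistrib matrix_diff_rdistrib
    by (simp add: middle_contract_invariant[OF C \<phi>] N)
  \<comment> \<open>\<open>W\<close> is replaced by its congruent copy; the left factor of that copy
    completes the congruence of \<open>inv_form\<close>, and the right factor ends up behind the
    endomorphism.\<close>
  have "g ** inv_endo a C = g ** inv_form a C ** (transpose g ** W ** g)"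
    unfolding inv_endo_def W_def[symmetric] W by (simp add: matrix_mul_assoc)
  also have "\<dots> = g ** inv_form a C ** transpose g ** W ** g" by (simp add: matrix_mul_assoc)
  also have "\<dots> = inv_endo a C ** g" unfolding G by (simp add: inv_endo_def W_def)
  finally have T: "g ** inv_endo a C = inv_endo a C ** g" .
  have kry: "g *v krylov a C n = krylov a C n" for n
  proof (induction n)
    case (Suc n)
    have "g *v krylov a C (Suc n) = (g ** inv_endo a C) *v krylov a C n"
      by (simp add: matrix_vector_mul_assoc)
    also have "\<dots> = inv_endo a C *v (g *v krylov a C n)"
      unfolding T by (simp add: matrix_vector_mul_assoc)
    finally show ?case using Suc by simp
  qed (simp add: s)
  have "g ** krylov_matrix \<iota> a C = krylov_matrix \<iota> a C"
    using kry by (simp add: krylov_matrix_def matrix_matrix_mult_def matrix_vector_mult_def vec_eq_iff)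
  moreover obtain B where "krylov_matrix \<iota> a C ** B = mat 1"
    using K invertible_det_nz[of "krylov_matrix \<iota> a C"] by (auto simp: invertible_def)
  ultimately show ?thesis by (metis matrix_mul_assoc matrix_mul_rid)
qed

section \<open>Polynomiality of the genericity condition\<close>

lemma tensor_polynomial_sum:
  assumes "\<And>x. x \<in> A \<Longrightarrow> tensor_polynomial (f x)"
  shows "tensor_polynomial (\<lambda>T. \<Sum>x\<in>A. f x T)"
  using assms by (induction A rule: infinite_finite_induct) (auto intro: tensor_polynomial.intros)

lemma tensor_polynomial_prod:
  assumes "\<And>x. x \<in> A \<Longrightarrow> tensor_polynomial (f x)"
  shows "tensor_polynomial (\<lambda>T. \<Prod>x\<in>A. f x T)"
  using assms by (induction A rule: infinite_finite_induct) (auto intro: tensor_polynomial.intros)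

lemma tensor_polynomial_diff:
  assumes "tensor_polynomial f" "tensor_polynomial g"
  shows "tensor_polynomial (\<lambda>T. f T - g T)"
  using tensor_polynomial.add[OF assms(1) tensor_polynomial.mult[OF tensor_polynomial.const[of "-1"] assms(2)]]
  by simp

lemma tensor_polynomial_det:
  fixes A :: "(complex, 'm::finite) tensor3 \<Rightarrow> complex ^ 'n::finite ^ 'n"
  assumes "\<And>i j. tensor_polynomial (\<lambda>T. A T $ i $ j)"
  shows "tensor_polynomial (\<lambda>T. det (A T))"
  unfolding det_def
  by (intro tensor_polynomial_sum tensor_polynomial.mult tensor_polynomial.const tensor_polynomial_prod assms)

lemma tensor_polynomial_matrix_mult:
  fixes A :: "(complex, 'm::finite) tensor3 \<Rightarrow> complex ^ 'n::finite ^ 'p::finite"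
  assumes "\<And>i j. tensor_polynomial (\<lambda>T. A T $ i $ j)" "\<And>i j. tensor_polynomial (\<lambda>T. B T $ i $ j)"
  shows "tensor_polynomial (\<lambda>T. (A T ** B T) $ i $ j)"
  unfolding matrix_matrix_mult_def
  by (simp, intro tensor_polynomial_sum tensor_polynomial.mult assms)

lemma tensor_polynomial_matrix_vector_mult:
  fixes A :: "(complex, 'm::finite) tensor3 \<Rightarrow> complex ^ 'n::finite ^ 'p::finite"
  assumes "\<And>i j. tensor_polynomial (\<lambda>T. A T $ i $ j)" "\<And>i. tensor_polynomial (\<lambda>T. v T $ i)"
  shows "tensor_polynomial (\<lambda>T. (A T *v v T) $ i)"
  unfolding matrix_vector_mult_def
  by (simp, intro tensor_polynomial_sum tensor_polynomial.mult assms)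

lemma tensor_polynomial_adjugate:
  fixes A :: "(complex, 'm::finite) tensor3 \<Rightarrow> complex ^ 'n::finite ^ 'n"
  assumes "\<And>i j. tensor_polynomial (\<lambda>T. A T $ i $ j)"
  shows "tensor_polynomial (\<lambda>T. adjugate (A T) $ k $ l)"
proof -
  have "tensor_polynomial (\<lambda>T. if j = k then (if i = l then 1 else 0) else A T $ i $ j)" for i j
    using assms by (cases "j = k") (auto intro: tensor_polynomial.const)
  then show ?thesis unfolding adjugate_def by (simp, intro tensor_polynomial_det) simp
qed

lemma tensor_polynomial_shuffle12: "tensor_polynomial (\<lambda>T. shuffle12 T i j k)"
  unfolding shuffle12_def by (intro tensor_polynomial.intros)

lemma tensor_polynomial_shuffle111: "tensor_polynomial (\<lambda>T. shuffle111 T i j k)"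
  unfolding shuffle111_def by (intro tensor_polynomial.add tensor_polynomial_shuffle12)

lemma tensor_polynomial_genericity: "tensor_polynomial (genericity \<iota> a)"
proof -
  have s: "tensor_polynomial (\<lambda>T. level1 a T $ i)" for i
    by (simp add: level1_def tensor_polynomial_shuffle111)
  have N: "tensor_polynomial (\<lambda>T. level2 a T $ i $ j)" for i j
    by (simp add: level2_def tensor_polynomial_shuffle12)
  note d = tensor_polynomial_det[OF N] and W = tensor_polynomial_adjugate[OF N]
  have tc: "tensor_polynomial (\<lambda>T. trace_contract T (adjugate (level2 a T)) $ i)" for i
    unfolding trace_contract_def trace_def
    by (simp, intro tensor_polynomial_sum tensor_polynomial_matrix_mult W)
       (simp add: tensor_polynomial.entry)
  have c: "tensor_polynomial (\<lambda>T. f T / r)" if "tensor_polynomial f" for f r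
    using tensor_polynomial.mult[OF that tensor_polynomial.const[of "1 / r"]] by simp
  have "tensor_polynomial (\<lambda>T. inv_vec a T $ i)" for i
    unfolding inv_vec_def by (simp, intro tensor_polynomial.add tensor_polynomial.mult c tc d s)
  then have "tensor_polynomial (\<lambda>T. inv_covec a T $ i)" for i
    unfolding inv_covec_def
    by (intro tensor_polynomial_matrix_vector_mult) (auto simp: transpose_def W)
  then have "tensor_polynomial (\<lambda>T. inv_form a T $ i $ j)" for i j
    unfolding inv_form_def middle_contract_def mat_matrix_mult power2_eq_square
    by (simp, intro tensor_polynomial_diff tensor_polynomial_sum tensor_polynomial.mult
        tensor_polynomial.entry c d N)
  then have T: "tensor_polynomial (\<lambda>T. inv_endo a T $ i $ j)" for i j
    unfolding inv_endo_def by (intro tensor_polynomial_matrix_mult W)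
  have "tensor_polynomial (\<lambda>T. krylov a T n $ i)" for n i
  proof (induction n arbitrary: i)
    case (Suc n)
    then show ?case by (simp, intro tensor_polynomial_matrix_vector_mult T)
  qed (simp add: s)
  then have "tensor_polynomial (\<lambda>T. krylov_matrix \<iota> a T $ i $ j)" for i j
    by (simp add: krylov_matrix_def)
  then show ?thesis
    unfolding genericity_def[abs_def]
    by (intro tensor_polynomial.mult s d tensor_polynomial_det)
qed

section \<open>Zariski closure and the shuffle identities on it\<close>

lemma zariski_closed_zeros: "tensor_polynomial f \<Longrightarrow> zariski_closed {T. f T = 0}"
  unfolding zariski_closed_def by (rule exI[of _ "{f}"]) auto

text \<open>The defining equations of all members are taken together. In particular the hull of a
  set is itself closed.\<close>

lemma zariski_closed_Inter:
  assumes "\<And>S. S \<in> \<S> \<Longrightarrow> zariski_closed S"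
  shows "zariski_closed (\<Inter>\<S>)"
proof -
  have "\<forall>S\<in>\<S>. \<exists>F. (\<forall>f\<in>F. tensor_polynomial f) \<and> S = {T. \<forall>f\<in>F. f T = 0}"
    using assms by (simp add: zariski_closed_def)
  then obtain F where F: "\<forall>S\<in>\<S>. (\<forall>f\<in>F S. tensor_polynomial f) \<and> S = {T. \<forall>f\<in>F S. f T = 0}"
    by (rule bchoice[THEN exE])
  show ?thesis
    unfolding zariski_closed_def
  proof (intro exI conjI)
    show "\<forall>f\<in>(\<Union>S\<in>\<S>. F S). tensor_polynomial f" using F by blast
    have "T \<in> S \<longleftrightarrow> (\<forall>f\<in>F S. f T = 0)" if "S \<in> \<S>" for S T
      using bspec[OF F that] by auto
    then show "\<Inter>\<S> = {T. \<forall>f\<in>(\<Union>S\<in>\<S>. F S). f T = 0}" by auto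
  qed
qed

lemma zariski_closed_universal_variety: "zariski_closed universal_variety"
  unfolding universal_variety_def by (rule hull_in) (simp add: zariski_closed_Inter)

text \<open>The zero set of \<open>f\<close> is closed and contains all signatures, hence also their
  closure.\<close>

lemma universal_variety_zero:
  assumes "tensor_polynomial f" "\<And>\<psi>. signature_path \<psi> \<Longrightarrow> f (signature3 \<psi>) = 0"
    and "T \<in> universal_variety"
  shows "f T = 0"
proof -
  have "universal_variety \<subseteq> {T. f T = 0}"
    unfolding universal_variety_def
    using assms(1,2) by (intro hull_minimal zariski_closed_zeros) auto
  then show ?thesis using assms(3) by blast
qed

text \<open>The third power identity with denominators cleared: on a signature both sides are P_a^6
  P_i P_j P_k. In this form it is polynomial in \<open>T\<close> and extends to points that need not
  come from a path.\<close>

lemma universal_variety_shuffle111: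
  assumes "T \<in> universal_variety"
  shows "(level1 a T $ a)^2 * shuffle111 T i j k = level1 a T $ i * level1 a T $ j * level1 a T $ k"
proof -
  have "level1 a T $ a * level1 a T $ a * shuffle111 T i j k - level1 a T $ i * level1 a T $ j * level1 a T $ k = 0"
  proof (rule universal_variety_zero[OF _ _ assms])
    show "tensor_polynomial (\<lambda>T. level1 a T $ a * level1 a T $ a * shuffle111 T i j k
        - level1 a T $ i * level1 a T $ j * level1 a T $ k)"
      unfolding level1_def by (simp, intro tensor_polynomial_diff tensor_polynomial.mult tensor_polynomial_shuffle111)
  qed (simp add: level1_def shuffle111_signature3)
  then show ?thesis by (simp add: power2_eq_square)
qed

text \<open>On a signature both sides are P_a^3 P_i M_jk.\<close>

lemma universal_variety_shuffle12:
  assumes "T \<in> universal_variety"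
  shows "level1 a T $ a * shuffle12 T i j k = level1 a T $ i * level2 a T $ j $ k"
proof -
  have "level1 a T $ a * shuffle12 T i j k - level1 a T $ i * level2 a T $ j $ k = 0"
  proof (rule universal_variety_zero[OF _ _ assms])
    show "tensor_polynomial (\<lambda>T. level1 a T $ a * shuffle12 T i j k - level1 a T $ i * level2 a T $ j $ k)"
      unfolding level1_def level2_def
      by (simp, intro tensor_polynomial_diff tensor_polynomial.mult tensor_polynomial_shuffle111
          tensor_polynomial_shuffle12)
  qed (simp add: level1_def level2_def shuffle111_signature3 shuffle12_signature3)
  then show ?thesis by simp
qed

section \<open>Trivial stabilizers at generic real points\<close>

lemma stabilizer_trivial_on_universal_variety:
  fixes C :: "(real, 'm::finite) tensor3" and h :: "real ^ 'm ^ 'm"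
  assumes U: "complex_tensor C \<in> universal_variety" and gen: "genericity \<iota> a (complex_tensor C) \<noteq> 0"
    and h: "\<lbrakk>C; h, h, h\<rbrakk> = C"
  shows "h = mat 1"
proof -
  let ?T = "complex_tensor C"
  define g :: "complex ^ 'm ^ 'm" where "g = (\<chi> i j. of_real (h $ i $ j))"
  define s where "s = level1 a ?T"
  define N where "N = level2 a ?T"
  have sa: "s $ a \<noteq> 0" using gen by (simp add: s_def genericity_def)
  have stab: "stabilizes g (\<lambda>i j k. ?T $ i $ j $ k)"
    unfolding stabilizes_def
  proof (intro allI)
    fix \<alpha> \<beta> \<gamma>
    have "(\<Sum>i\<in>UNIV. \<Sum>j\<in>UNIV. \<Sum>k\<in>UNIV. ?T $ i $ j $ k * g $ \<alpha> $ i * g $ \<beta> $ j * g $ \<gamma> $ k)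
        = of_real (\<lbrakk>C; h, h, h\<rbrakk> $ \<alpha> $ \<beta> $ \<gamma>)"
      by (simp add: multilinear_mult_def complex_tensor_def g_def)
    then show "(\<Sum>i\<in>UNIV. \<Sum>j\<in>UNIV. \<Sum>k\<in>UNIV. ?T $ i $ j $ k * g $ \<alpha> $ i * g $ \<beta> $ j * g $ \<gamma> $ k)
        = ?T $ \<alpha> $ \<beta> $ \<gamma>"
      by (simp add: h complex_tensor_def)
  qed
  \<comment> \<open>The cube of \<open>s\<close> is a scalar multiple of \<open>shuffle111\<close>,
    hence fixed. Its last two factors are packed into a matrix so that the action factors.\<close>
  have "stabilizes g (\<lambda>i j k. s $ i * (\<chi> j k. s $ j * s $ k) $ j $ k)"
    using stabilizes_scale[OF stabilizes_shuffle111[OF stab], of "(s $ a)^2"]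
    by (simp add: s_def universal_variety_shuffle111[OF U] mult.assoc)
  note cube = stabilizes_vec_form[OF this]
  have "(g ** (\<chi> j k. s $ j * s $ k) ** transpose g) $ \<beta> $ \<gamma> = (g *v s) $ \<beta> * (g *v s) $ \<gamma>" for \<beta> \<gamma>
    unfolding congruence_entry by (simp add: matrix_vector_mult_def sum_product mult_ac)
  with cube have cube: "((g *v s) $ i) ^ 3 = (s $ i) ^ 3" for i
    by (simp add: power3_eq_cube mult.assoc)
  define r where "r = (\<chi> i. Re (s $ i))"
  have s_real: "s $ i = of_real (r $ i)" for i
    by (simp add: r_def s_def level1_def shuffle111_def shuffle12_def complex_tensor_def complex_eq_iff)
  have "(g *v s) $ i = of_real ((h *v r) $ i)" for i
    by (simp add: matrix_vector_mult_def g_def s_real)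
  with cube[of i for i] s_real have "complex_of_real (((h *v r) $ i) ^ 3) = of_real ((r $ i) ^ 3)" for i
    by simp
  then have "((h *v r) $ i) ^ 3 = (r $ i) ^ 3" for i
    using of_real_eq_iff by blast
  \<comment> \<open>Here reality is decisive: over the complex numbers a cube root of unity times
    the identity fixes every third order tensor, but real cubes have a unique real root.\<close>
  then have "(h *v r) $ i = r $ i" for i
    using odd_real_root_power_cancel[of 3] by (metis odd_numeral)
  then have gs: "g *v s = s"
    by (simp add: vec_eq_iff s_real \<open>\<And>i. (g *v s) $ i = of_real ((h *v r) $ i)\<close>)
  have "stabilizes g (\<lambda>i j k. s $ i * N $ j $ k)"
    using stabilizes_scale[OF stabilizes_shuffle12[OF stab], of "s $ a"]
    by (simp add: s_def N_def universal_variety_shuffle12[OF U])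
  \<comment> \<open>At index \<open>a\<close> in the first slot the common nonzero factor cancels,
    which removes the scalar ambiguity.\<close>
  from stabilizes_vec_form[OF this, of a] have gN: "g ** N ** transpose g = N"
    using sa by (simp add: gs vec_eq_iff)
  have "g = mat 1"
    using stab gs gN gen unfolding s_def N_def by (rule stabilizer_trivial)
  then show ?thesis
    by (simp add: g_def vec_eq_iff mat_def of_real_eq_1_iff split: if_splits) blast
qed

section \<open>Recovery of a rectangular matrix from a trivial stabilizer\<close>

lemma multilinear_mult_comp:
  fixes A :: "real ^ 'd::finite ^ 'e::finite"
  shows "\<lbrakk>\<lbrakk>C; X, Y, Z\<rbrakk>; A, B, D\<rbrakk> = \<lbrakk>C; A ** X, B ** Y, D ** Z\<rbrakk>"
proof -
  have swap: "(\<Sum>a\<in>UNIV. \<Sum>b\<in>UNIV. \<Sum>c\<in>UNIV. \<Sum>i\<in>UNIV. \<Sum>j\<in>UNIV. \<Sum>k\<in>UNIV. f a b c i j k) =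
      (\<Sum>i\<in>UNIV. \<Sum>j\<in>UNIV. \<Sum>k\<in>UNIV. \<Sum>a\<in>UNIV. \<Sum>b\<in>UNIV. \<Sum>c\<in>UNIV. f a b c i j k)"
    for f :: "'d \<Rightarrow> 'd \<Rightarrow> 'd \<Rightarrow> 'b \<Rightarrow> 'b \<Rightarrow> 'b \<Rightarrow> real"
    unfolding sum.cartesian_product
    by (rule sum.reindex_bij_witness[of _ "\<lambda>(i, j, k, a, b, c). (a, b, c, i, j, k)"
          "\<lambda>(a, b, c, i, j, k). (i, j, k, a, b, c)"]) auto
  have prod3: "(\<Sum>a\<in>UNIV. p a) * (\<Sum>b\<in>UNIV. q b) * (\<Sum>c\<in>UNIV. r c) = (\<Sum>a\<in>UNIV. \<Sum>b\<in>UNIV. \<Sum>c\<in>UNIV. p a * q b * r c)"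
    for p q r :: "'d \<Rightarrow> real"
    by (simp only: sum_product) (simp only: sum_distrib_left sum_distrib_right, rule sum.cong[OF refl], rule sum.swap)
  have "\<lbrakk>\<lbrakk>C; X, Y, Z\<rbrakk>; A, B, D\<rbrakk> $ \<alpha> $ \<beta> $ \<gamma> = \<lbrakk>C; A ** X, B ** Y, D ** Z\<rbrakk> $ \<alpha> $ \<beta> $ \<gamma>" for \<alpha> \<beta> \<gamma>
  proof -
    have "\<lbrakk>\<lbrakk>C; X, Y, Z\<rbrakk>; A, B, D\<rbrakk> $ \<alpha> $ \<beta> $ \<gamma> =
      (\<Sum>a\<in>UNIV. \<Sum>b\<in>UNIV. \<Sum>c\<in>UNIV. \<Sum>i\<in>UNIV. \<Sum>j\<in>UNIV. \<Sum>k\<in>UNIV.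
        C $ i $ j $ k * ((A $ \<alpha> $ a * X $ a $ i) * (B $ \<beta> $ b * Y $ b $ j) * (D $ \<gamma> $ c * Z $ c $ k)))"
      by (simp add: multilinear_mult_def sum_distrib_left mult_ac)
    also have "\<dots> = (\<Sum>i\<in>UNIV. \<Sum>j\<in>UNIV. \<Sum>k\<in>UNIV. \<Sum>a\<in>UNIV. \<Sum>b\<in>UNIV. \<Sum>c\<in>UNIV.
        C $ i $ j $ k * ((A $ \<alpha> $ a * X $ a $ i) * (B $ \<beta> $ b * Y $ b $ j) * (D $ \<gamma> $ c * Z $ c $ k)))"
      by (rule swap)
    also have "\<dots> = (\<Sum>i\<in>UNIV. \<Sum>j\<in>UNIV. \<Sum>k\<in>UNIV.
        C $ i $ j $ k * ((A ** X) $ \<alpha> $ i * (B ** Y) $ \<beta> $ j * (D ** Z) $ \<gamma> $ k))"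
      by (simp add: matrix_matrix_mult_def prod3 flip: sum_distrib_left)
    finally show ?thesis by (simp add: multilinear_mult_def mult.assoc)
  qed
  then show ?thesis by (simp add: vec_eq_iff)
qed

lemma multilinear_mult_mat_1: "\<lbrakk>C; mat 1, mat 1, mat 1\<rbrakk> = C"
  by (simp add: multilinear_mult_def mat_def vec_eq_iff if_distrib[of "\<lambda>x. _ * x"] cong: if_cong)

text \<open>
  Every left inverse of \<open>X\<close> is a left inverse of \<open>Y\<close> as well; comparing \<open>L\<close> with the left inverses
  \<open>L + E ** (mat 1 - X ** L)\<close> for arbitrary \<open>E\<close> yields \<open>X ** L ** Y = Y\<close>.
\<close>

lemma unique_recovery:
  fixes X Y :: "real ^ 'm::finite ^ 'd::finite"
  assumes C: "\<And>h :: real ^ 'm ^ 'm. \<lbrakk>C; h, h, h\<rbrakk> = C \<Longrightarrow> h = mat 1"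
    and X: "rank X = CARD('m)" and eq: "\<lbrakk>C; X, X, X\<rbrakk> = \<lbrakk>C; Y, Y, Y\<rbrakk>"
  shows "Y = X"
proof -
  have left_inverse: "A ** Y = mat 1" if "A ** X = mat 1" for A :: "real ^ 'd ^ 'm"
  proof (rule C)
    \<comment> \<open>Applying \<open>A\<close> to all slots of \<open>eq\<close> turns the side of
      \<open>X\<close> into \<open>C\<close>, so \<open>A ** Y\<close> stabilizes
      \<open>C\<close>.\<close>
    have "\<lbrakk>C; A ** Y, A ** Y, A ** Y\<rbrakk> = \<lbrakk>\<lbrakk>C; X, X, X\<rbrakk>; A, A, A\<rbrakk>"
      unfolding eq by (rule multilinear_mult_comp[symmetric])
    then show "\<lbrakk>C; A ** Y, A ** Y, A ** Y\<rbrakk> = C"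
      by (simp add: multilinear_mult_comp that multilinear_mult_mat_1)
  qed
  obtain L where L: "L ** X = mat 1"
    using X full_rank_injective matrix_left_invertible_injective by blast
  define R where "R = Y - X ** (L ** Y)"
  have "E ** R = 0" for E :: "real ^ 'd ^ 'm"
  proof -
    let ?A = "L + (E - E ** X ** L)"
    have "E ** X ** L ** X = E ** X"
      by (simp add: L flip: matrix_mul_assoc)
    then have "?A ** X = mat 1"
      by (simp add: matrix_add_rdistrib matrix_diff_rdistrib L)
    then have "?A ** Y = mat 1" by (rule left_inverse)
    then have "E ** Y - E ** X ** L ** Y = 0"
      by (simp add: matrix_add_rdistrib matrix_diff_rdistrib left_inverse[OF L])
    then show ?thesis
      by (simp add: R_def matrix_diff_ldistrib matrix_mul_assoc)
  qed
  \<comment> \<open>Every row of this choice of \<open>E\<close> is the same unit covector, so every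
    row of the product is row \<alpha> of \<open>R\<close>.\<close>
  then have "(\<chi> i j. if j = \<alpha> then 1 else 0) ** R = (0 :: real ^ 'm ^ 'm)" for \<alpha> by blast
  then have "R $ \<alpha> $ k = 0" for \<alpha> k
    by (simp add: vec_eq_iff matrix_matrix_mult_def if_distrib[of "\<lambda>x. x * _"] cong: if_cong)
  then show "Y = X"
    by (simp add: R_def vec_eq_iff left_inverse[OF L])
qed

section \<open>The signature tensor of the axis path\<close>

text \<open>The third level of exp(e_1) ... exp(e_m) in the tensor algebra, ordered by
  \<open>\<iota>\<close>: a weakly increasing word has as coefficient the reciprocal of the product
  of the factorials of its letter multiplicities.\<close>

definition axis_tensor :: "('m \<Rightarrow> nat) \<Rightarrow> (complex, 'm::finite) tensor3"
  where "axis_tensor \<iota> = (\<chi> i j k.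
    if \<iota> i < \<iota> j then (if \<iota> j < \<iota> k then 1 else if \<iota> j = \<iota> k then 1 / 2 else 0)
    else if \<iota> i = \<iota> j then (if \<iota> j < \<iota> k then 1 / 2 else if \<iota> j = \<iota> k then 1 / 6 else 0)
    else 0)"

lemma sum_single:
  fixes f :: "'m::finite \<Rightarrow> 'a::comm_monoid_add"
  assumes "\<And>j. j \<noteq> i \<Longrightarrow> f j = 0"
  shows "(\<Sum>j\<in>UNIV. f j) = f i"
  using assms by (subst sum.remove[of _ i]) auto

lemma axis_tensor_entry:
  "axis_tensor \<iota> $ i $ j $ k =
    (if \<iota> i < \<iota> j then (if \<iota> j < \<iota> k then 1 else if \<iota> j = \<iota> k then 1 / 2 else 0)
    else if \<iota> i = \<iota> j then (if \<iota> j < \<iota> k then 1 / 2 else if \<iota> j = \<iota> k then 1 / 6 else 0)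
    else 0)"
  by (simp add: axis_tensor_def)

lemma level2_axis:
  "level2 a (axis_tensor \<iota>) $ j $ k = (if \<iota> j < \<iota> k then 1 else if \<iota> j = \<iota> k then 1 / 2 else 0)"
  by (simp add: level2_def shuffle12_def axis_tensor_def)

lemma level1_axis: "level1 a (axis_tensor \<iota>) $ i = 1"
  by (simp add: level1_def shuffle111_def shuffle12_def axis_tensor_def)

lemma index_less:
  fixes \<iota> :: "'m::finite \<Rightarrow> nat"
  assumes "bij_betw \<iota> UNIV {..<CARD('m)}"
  shows "\<iota> i < CARD('m)"
  using assms by (auto simp: bij_betw_def)

context
  fixes \<iota> :: "'m::finite \<Rightarrow> nat" and a :: 'm
  assumes \<iota>: "bij_betw \<iota> UNIV {..<CARD('m)}"
begin

private lemma \<iota>_eq_iff: "\<iota> i = \<iota> j \<longleftrightarrow> i = j"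
  using \<iota> by (auto simp: bij_betw_def inj_eq)

private lemma \<iota>_surj: "r < CARD('m) \<Longrightarrow> \<exists>i. \<iota> i = r"
  using \<iota> by (metis bij_betw_iff_bijections lessThan_iff)

private lemma card_below: "card {j. \<iota> j < \<iota> k} = \<iota> k"
proof -
  have "\<iota> ` {j. \<iota> j < \<iota> k} = {..<\<iota> k}"
  proof
    show "{..<\<iota> k} \<subseteq> \<iota> ` {j. \<iota> j < \<iota> k}"
    proof
      fix r assume "r \<in> {..<\<iota> k}"
      then show "r \<in> \<iota> ` {j. \<iota> j < \<iota> k}"
        using \<iota>_surj[of r] index_less[OF \<iota>, of k] by auto
    qed
  qed auto
  moreover have "inj_on \<iota> {j. \<iota> j < \<iota> k}"
    using \<iota>_eq_iff by (simp add: inj_on_def)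
  ultimately show ?thesis using card_image by fastforce
qed

private lemma sum_below:
  "(\<Sum>j\<in>UNIV. if \<iota> j < \<iota> k then c else if j = k then d else 0) = of_nat (\<iota> k) * c + (d :: complex)"
proof -
  have "(\<Sum>j\<in>UNIV. if \<iota> j < \<iota> k then c else if j = k then d else 0)
    = (\<Sum>j\<in>UNIV. (if \<iota> j < \<iota> k then c else 0) + (if j = k then d else 0))"
    by (intro sum.cong) auto
  also have "\<dots> = of_nat (\<iota> k) * c + d"
    by (simp add: sum.distrib card_below flip: sum.inter_filter)
  finally show ?thesis .
qed

section \<open>Triangularity and the invariants of the axis tensor\<close>

private abbreviation "T \<equiv> axis_tensor \<iota>"
private abbreviation "N \<equiv> level2 a T"
private abbreviation "W \<equiv> adjugate N"

text \<open>In the order of \<open>\<iota>\<close> the matrix is upper triangular with diagonal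
  entries 1/2.\<close>

private lemma N_top:
  assumes "\<And>j. \<iota> i < \<iota> j \<Longrightarrow> x $ j = 0"
  shows "(N *v x) $ i = x $ i / 2"
proof -
  have "(N *v x) $ i = N $ i $ i * x $ i"
    unfolding matrix_vector_mult_def
    using assms \<iota>_eq_iff by (simp, intro sum_single) (auto simp: level2_axis)
  then show ?thesis by (simp add: level2_axis)
qed

text \<open>The triangular system is solved from the last index downwards, so a vanishing tail of
  the right-hand side is inherited by the solution.\<close>

private lemma N_back_substitution:
  assumes "\<And>i. r \<le> \<iota> i \<Longrightarrow> (N *v x) $ i = 0" and "r \<le> \<iota> i"
  shows "x $ i = 0"
  using assms(2)
proof (induction "CARD('m) - \<iota> i" arbitrary: i rule: less_induct)
  case less
  have "x $ j = 0" if "\<iota> i < \<iota> j" for j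
    using that less.prems index_less[OF \<iota>, of j] by (intro less.hyps) auto
  then show ?case using N_top[of i x] assms(1)[OF less.prems] by simp
qed

private lemma det_N: "det N \<noteq> 0"
proof -
  have "x = 0" if "N *v x = 0" for x
    using N_back_substitution[of 0 x] that by (simp add: vec_eq_iff)
  then show ?thesis
    by (metis invertible_det_nz invertible_left_inverse matrix_left_invertible_ker)
qed

private lemma N_W: "N ** W = mat (det N)" and W_N: "W ** N = mat (det N)"
  using matrix_mult_adjugate[OF det_N] matrix_mult_eq_mat_commute[OF _ det_N] by blast+

text \<open>\<open>W\<close> is det N times the inverse of a triangular matrix with diagonal 1/2, so
  its diagonal entries are 2 det N.\<close>

private lemma W_diag: "W $ k $ k = 2 * det N"
proof -
  define x where "x = (\<chi> i. W $ i $ k)"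
  have Nx: "(N *v x) $ i = (if i = k then det N else 0)" for i
  proof -
    have "(N *v x) $ i = (N ** W) $ i $ k"
      by (simp add: x_def matrix_vector_mult_def matrix_matrix_mult_def)
    then show ?thesis unfolding N_W by (simp add: mat_def)
  qed
  have "x $ j = 0" if "\<iota> k < \<iota> j" for j
    using that by - (rule N_back_substitution[of "Suc (\<iota> k)"], auto simp: Nx)
  then have "x $ k / 2 = det N" using N_top[of k x] Nx[of k] by simp
  then show ?thesis by (simp add: x_def field_simps)
qed

text \<open>For fixed j before k the slice column agrees with that of \<open>N\<close> and pairs
  with \<open>W\<close> to det N; there are \<open>\<iota> k\<close> such j. The index j = k
  contributes det N / 3.\<close>

private lemma trace_contract_axis: "trace_contract T W $ k = det N * (of_nat (\<iota> k) + 1 / 3)"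
proof -
  have WN: "(\<Sum>i\<in>UNIV. N $ i $ j * W $ j $ i) = det N" for j
    using arg_cong[OF W_N, of "\<lambda>A. A $ j $ j"]
    by (simp add: matrix_matrix_mult_def mat_def mult.commute)
  \<comment> \<open>The correction 1/12 is the gap between N_kk / 2 = 1/4 and T_kkk = 1/6.\<close>
  have T: "T $ i $ j $ k = (if \<iota> j < \<iota> k then N $ i $ j
      else if j = k then N $ i $ j / 2 - (if i = k then 1 / 12 else 0) else 0)" for i j
    using \<iota>_eq_iff by (auto simp: axis_tensor_entry level2_axis)
  have "(\<Sum>i\<in>UNIV. T $ i $ j $ k * W $ j $ i)
      = (if \<iota> j < \<iota> k then det N else if j = k then det N / 3 else 0)" for j
  proof -
    consider "\<iota> j < \<iota> k" | "j = k" | "\<not> \<iota> j < \<iota> k" "j \<noteq> k" by blast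
    then show ?thesis
    proof cases
      case 2
      have "(\<Sum>i\<in>UNIV. T $ i $ k $ k * W $ k $ i)
          = (\<Sum>i\<in>UNIV. N $ i $ k * W $ k $ i) / 2 - (\<Sum>i\<in>UNIV. if i = k then W $ k $ i / 12 else 0)"
        unfolding sum_divide_distrib sum_subtractf[symmetric]
        by (intro sum.cong) (auto simp: T left_diff_distrib)
      with 2 show ?thesis by (simp add: WN W_diag)
    qed (simp_all add: T WN)
  qed
  moreover have "trace_contract T W $ k = (\<Sum>j\<in>UNIV. \<Sum>i\<in>UNIV. T $ i $ j $ k * W $ j $ i)"
    unfolding trace_contract_def trace_def matrix_matrix_mult_def by (simp, rule sum.swap)
  ultimately show ?thesis by (simp add: sum_below algebra_simps)
qed

text \<open>The summand 1/6 in \<open>inv_vec\<close> turns \<open>\<iota> k\<close> + 1/3 into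
  \<open>\<iota> k\<close> + 1/2, the column sum of \<open>N\<close>. Hence \<open>inv_vec\<close>
  is det N times the transpose of \<open>N\<close> applied to the all-ones vector, and the
  transposed adjugate undoes that matrix up to det N.\<close>

private lemma inv_covec_axis: "inv_covec a T $ i = (det N)\<^sup>2"
proof -
  have "(transpose N *v 1) $ k = of_nat (\<iota> k) + 1 / 2" for k
    using sum_below[of k 1 "1 / 2"]
    by (simp add: matrix_vector_mult_def transpose_def level2_axis \<iota>_eq_iff cong: if_cong)
  then have "inv_vec a T = det N *s (transpose N *v 1)"
    by (simp add: inv_vec_def vec_eq_iff trace_contract_axis level1_axis algebra_simps)
  then have "inv_covec a T = det N *s ((transpose W ** transpose N) *v 1)"
    by (simp only: inv_covec_def vec.scale matrix_vector_mul_assoc)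
  also have "transpose W ** transpose N = mat (det N)"
    by (simp add: N_W flip: matrix_transpose_mul)
  finally show ?thesis
    by (simp add: power2_eq_square matrix_vector_mult_def mat_def if_distrib[of "\<lambda>x. x * _"] cong: if_cong)
qed

private lemma inv_form_axis:
  "inv_form a T $ i $ k = (det N)\<^sup>2 * ((\<Sum>j\<in>UNIV. T $ i $ j $ k) - N $ i $ k / 3)"
  by (simp add: inv_form_def middle_contract_def inv_covec_axis mat_matrix_mult algebra_simps
      sum_distrib_left)

text \<open>The coefficient 1/3 is chosen to clear the diagonal: T_iii = 1/6 = N_ii / 3. Below the
  diagonal both terms vanish.\<close>

private lemma inv_form_axis_lower:
  assumes "\<iota> k \<le> \<iota> i" shows "inv_form a T $ i $ k = 0"
proof -
  have "(\<Sum>j\<in>UNIV. T $ i $ j $ k) = T $ i $ i $ k"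
    using assms \<iota>_eq_iff by (intro sum_single) (auto simp: axis_tensor_entry)
  moreover have "T $ i $ i $ k = N $ i $ k / 3"
    using assms by (simp add: axis_tensor_entry level2_axis)
  ultimately show ?thesis by (simp add: inv_form_axis)
qed

private lemma inv_form_axis_superdiag:
  assumes "\<iota> k = Suc (\<iota> i)" shows "inv_form a T $ i $ k \<noteq> 0"
proof -
  \<comment> \<open>No index lies strictly between i and k, so only j = i and j = k contribute. The
    total 1 exceeds N_ik / 3 = 1/3.\<close>
  have "(\<Sum>j\<in>UNIV. T $ i $ j $ k) = (\<Sum>j\<in>UNIV. (if j = i then 1 / 2 else 0) + (if j = k then 1 / 2 else 0))"
    using assms by (intro sum.cong refl) (auto simp: axis_tensor_entry simp flip: \<iota>_eq_iff)
  then show ?thesis using assms det_N by (simp add: inv_form_axis sum.distrib level2_axis)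
qed

text \<open>The last nonzero entry of the t-th Krylov vector sits at position m - 1 - t, counted
  from 0. The triangular \<open>W\<close> keeps this position; the strictly triangular form, with
  its nonzero superdiagonal, moves it up by exactly one.\<close>

private lemma krylov_axis:
  "t < CARD('m) \<Longrightarrow> (\<forall>i. CARD('m) \<le> \<iota> i + t \<longrightarrow> krylov a T t $ i = 0) \<and>
    (\<forall>i. CARD('m) = Suc (\<iota> i + t) \<longrightarrow> krylov a T t $ i \<noteq> 0)"
proof (induction t)
  case 0
  then show ?case using index_less[OF \<iota>] by (auto simp: level1_axis not_le)
next
  case (Suc t)
  let ?n = "CARD('m)"
  define v where "v = krylov a T t"
  define x where "x = W *v v"
  have v: "v $ i = 0" if "?n \<le> \<iota> i + t" for i using Suc that by (simp add: v_def)
  have v': "v $ i \<noteq> 0" if "?n = Suc (\<iota> i + t)" for i using Suc that by (simp add: v_def)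
  have Nx: "(N *v x) $ i = det N * v $ i" for i
    by (simp add: x_def matrix_vector_mul_assoc N_W)
       (simp add: matrix_vector_mult_def mat_def if_distrib[of "\<lambda>x. x * _"] cong: if_cong)
  have x: "x $ i = 0" if "?n \<le> \<iota> i + t" for i
    using that by - (rule N_back_substitution[of "?n - t"], auto simp: Nx v)
  have x': "x $ i \<noteq> 0" if "?n = Suc (\<iota> i + t)" for i
  proof -
    have "x $ i / 2 = det N * v $ i"
      using that by (subst N_top[symmetric]) (auto simp: x Nx)
    then show ?thesis using v'[OF that] det_N by auto
  qed
  have kry: "krylov a T (Suc t) $ i = (\<Sum>k\<in>UNIV. inv_form a T $ i $ k * x $ k)" for i
    by (simp add: x_def v_def inv_endo_def flip: matrix_vector_mul_assoc)
       (simp add: matrix_vector_mult_def)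
  show ?case
  proof (intro conjI allI impI)
    fix i assume i: "?n \<le> \<iota> i + Suc t"
    have "inv_form a T $ i $ k * x $ k = 0" for k
      using i inv_form_axis_lower[of k i] x[of k] by (cases "\<iota> k \<le> \<iota> i") auto
    then show "krylov a T (Suc t) $ i = 0"
      unfolding kry by (intro sum.neutral ballI)
  next
    fix i assume i: "?n = Suc (\<iota> i + Suc t)"
    then obtain k where k: "\<iota> k = Suc (\<iota> i)" using \<iota>_surj[of "Suc (\<iota> i)"] by auto
    have "inv_form a T $ i $ j * x $ j = 0" if "j \<noteq> k" for j
    proof (cases "\<iota> j \<le> \<iota> i")
      case False
      moreover have "\<iota> j \<noteq> \<iota> k" using that \<iota>_eq_iff by simp
      ultimately show ?thesis using i k x[of j] by simp
    qed (simp add: inv_form_axis_lower)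
    then have "krylov a T (Suc t) $ i = inv_form a T $ i $ k * x $ k"
      unfolding kry by (rule sum_single)
    then show "krylov a T (Suc t) $ i \<noteq> 0"
      using inv_form_axis_superdiag[OF k] x'[of k] i k by simp
  qed
qed

text \<open>The last nonzero entries of the columns lie in pairwise different rows, so the matrix is
  triangular up to reversing the column order.\<close>

private lemma det_krylov_axis: "det (krylov_matrix \<iota> a T) \<noteq> 0"
proof -
  let ?K = "transpose (krylov_matrix \<iota> a T)"
  have "\<xi> = 0" if \<xi>: "?K *v \<xi> = 0" for \<xi>
  proof -
    have "\<xi> $ i = 0" for i
    proof (induction "\<iota> i" arbitrary: i rule: less_induct)
      case less
      \<comment> \<open>The column whose last nonzero entry is in row \<open>i\<close>: later rows
        vanish in it, and earlier entries of the kernel vector vanish by induction.\<close>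
      obtain j where j: "\<iota> j = CARD('m) - Suc (\<iota> i)"
        using \<iota>_surj[of "CARD('m) - Suc (\<iota> i)"] by auto
      then have n: "CARD('m) = Suc (\<iota> i + \<iota> j)" using index_less[OF \<iota>, of i] by simp
      note kry = krylov_axis[OF index_less[OF \<iota>, of j]]
      have "krylov a T (\<iota> j) $ l * \<xi> $ l = 0" if "l \<noteq> i" for l
      proof (cases "\<iota> l < \<iota> i")
        case False
        moreover have "\<iota> l \<noteq> \<iota> i" using that \<iota>_eq_iff by simp
        ultimately have "CARD('m) \<le> \<iota> l + \<iota> j" using n by simp
        then show ?thesis using kry by simp
      qed (simp add: less.hyps)
      then have "(\<Sum>l\<in>UNIV. krylov a T (\<iota> j) $ l * \<xi> $ l) = krylov a T (\<iota> j) $ i * \<xi> $ i"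
        by (rule sum_single)
      moreover have "(\<Sum>l\<in>UNIV. krylov a T (\<iota> j) $ l * \<xi> $ l) = (?K *v \<xi>) $ j"
        by (simp add: matrix_vector_mult_def transpose_def krylov_matrix_def)
      ultimately show ?case using \<xi> kry n by simp
    qed
    then show ?thesis by (simp add: vec_eq_iff)
  qed
  then have "det ?K \<noteq> 0"
    by (metis invertible_det_nz invertible_left_inverse matrix_left_invertible_ker)
  then show ?thesis by simp
qed

lemma genericity_axis: "genericity \<iota> a (axis_tensor \<iota>) \<noteq> 0"
  by (simp add: genericity_def level1_axis det_N det_krylov_axis)

end

section \<open>The axis path\<close>

text \<open>This clamps x to [0, 1]; absolute values make continuity and the derivative follow from
  closure rules.\<close>

definition ramp :: "real \<Rightarrow> real"
  where "ramp x = (\<bar>x\<bar> - \<bar>x - 1\<bar> + 1) / 2"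

definition ramp_slope :: "real \<Rightarrow> real"
  where "ramp_slope x = (sgn x - sgn (x - 1)) / 2"

lemma ramp_simps: "x \<le> 0 \<Longrightarrow> ramp x = 0" "0 \<le> x \<Longrightarrow> x \<le> 1 \<Longrightarrow> ramp x = x" "1 \<le> x \<Longrightarrow> ramp x = 1"
  by (auto simp: ramp_def)

lemma ramp_slope_simps: "x < 0 \<Longrightarrow> ramp_slope x = 0" "0 < x \<Longrightarrow> x < 1 \<Longrightarrow> ramp_slope x = 1" "1 < x \<Longrightarrow> ramp_slope x = 0"
  by (auto simp: ramp_slope_def)

lemma abs_has_real_derivative:
  assumes "x \<noteq> 0" shows "((\<lambda>x::real. \<bar>x\<bar>) has_real_derivative sgn x) (at x)"
proof (rule has_field_derivative_transform_within_open)
  show "((\<lambda>y. sgn x * y) has_real_derivative sgn x) (at x)"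
    by (auto intro!: derivative_eq_intros)
  show "open (if 0 < x then {0::real<..} else {..<0})" by simp
qed (use assms in \<open>auto split: if_splits\<close>)

lemma ramp_has_real_derivative:
  assumes "x \<noteq> 0" "x \<noteq> 1"
  shows "(ramp has_real_derivative ramp_slope x) (at x)"
proof -
  have "((\<lambda>x. \<bar>x - 1\<bar>) has_real_derivative sgn (x - 1) * 1) (at x)"
    using assms by (intro DERIV_chain2[OF abs_has_real_derivative]) (auto intro!: derivative_eq_intros)
  then show ?thesis
    unfolding ramp_def[abs_def] ramp_slope_def using abs_has_real_derivative[OF assms(1)]
    by (auto intro!: derivative_eq_intros)
qed

text \<open>With m the dimension, coordinate i rises from 0 to 1 during the time interval from
  \<open>\<iota> i\<close> / m to (\<open>\<iota> i\<close> + 1) / m and is constant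
  otherwise.\<close>

definition axis_path :: "('m \<Rightarrow> nat) \<Rightarrow> real \<Rightarrow> complex ^ 'm::finite"
  where "axis_path \<iota> t = (\<Sum>i\<in>UNIV. ramp (real CARD('m) * t - real (\<iota> i)) *\<^sub>R axis i 1)"

lemma sum_scaleR_axis_nth: "(\<Sum>j\<in>UNIV. c j *\<^sub>R axis j (1 :: complex)) $ i = of_real (c i)"
  unfolding sum_component
  by (subst sum_single[of i]) (auto simp: axis_def of_real_def)

context
  fixes \<iota> :: "'m::finite \<Rightarrow> nat"
  assumes \<iota>: "bij_betw \<iota> UNIV {..<CARD('m)}"
begin

section \<open>Regularity of the axis path\<close>

private definition n :: real where "n = real CARD('m)"

private definition S :: "real set" where "S = (\<lambda>r. real r / n) ` {..CARD('m)}"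

private lemma n_pos: "0 < n"
  by (simp add: n_def)

private lemma finite_S: "finite S"
  by (simp add: S_def)

private lemma breakpoints: "t \<notin> S \<Longrightarrow> n * t - real (\<iota> i) \<noteq> 0 \<and> n * t - real (\<iota> i) \<noteq> 1"
proof -
  assume t: "t \<notin> S"
  have "t \<noteq> real r / n" if "r \<le> CARD('m)" for r
    using t that by (auto simp: S_def)
  from this[of "\<iota> i"] this[of "Suc (\<iota> i)"] index_less[OF \<iota>, of i] n_pos show ?thesis
    by (auto simp: field_simps)
qed

private definition speed :: "'m \<Rightarrow> real \<Rightarrow> real"
  where "speed i t = ramp_slope (n * t - real (\<iota> i)) * n"

private lemma coordinate_derivative:
  assumes "t \<notin> S"
  shows "((\<lambda>t. ramp (n * t - real (\<iota> i))) has_real_derivative speed i t) (at t)"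
  unfolding speed_def using breakpoints[OF assms]
  by (intro DERIV_chain2[OF ramp_has_real_derivative]) (auto intro!: derivative_eq_intros)

private lemma axis_path_derivative:
  assumes "t \<notin> S"
  shows "(axis_path \<iota> has_vector_derivative (\<Sum>i\<in>UNIV. speed i t *\<^sub>R axis i 1)) (at t)"
  unfolding axis_path_def[abs_def] n_def[symmetric]
proof (rule has_vector_derivative_sum)
  fix i :: 'm
  show "((\<lambda>t. ramp (n * t - real (\<iota> i)) *\<^sub>R axis i (1 :: complex)) has_vector_derivative
      speed i t *\<^sub>R axis i 1) (at t)"
    using has_vector_derivative_scaleR[OF coordinate_derivative[OF assms] has_vector_derivative_const]
    by simp
qed

private lemma velocity_axis_path: "t \<notin> S \<Longrightarrow> velocity (axis_path \<iota>) i t = of_real (speed i t)"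
proof -
  assume "t \<notin> S"
  then have "velocity (axis_path \<iota>) i t = (\<Sum>j\<in>UNIV. speed j t *\<^sub>R axis j 1) $ i"
    unfolding velocity_def using vector_derivative_at[OF axis_path_derivative] by metis
  then show ?thesis by (simp only: sum_scaleR_axis_nth)
qed

private lemma continuous_coordinate: "continuous_on A (\<lambda>t. ramp (n * t - real (\<iota> i)))"
  unfolding ramp_def by (intro continuous_intros) auto

private lemma continuous_speed: "continuous_on ({0..1} - S) (speed i)"
  unfolding speed_def[abs_def] ramp_slope_def using breakpoints
  by (intro continuous_intros) (auto simp: algebra_simps)

text \<open>Each coordinate is monotone, so its speed is nonnegative and plain integrability, from
  the fundamental theorem, suffices.\<close>

private lemma speed_absolutely_integrable: "speed i absolutely_integrable_on {0..1}"
proof (rule nonnegative_absolutely_integrable_1)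
  have "(speed i has_integral ramp (n * 1 - real (\<iota> i)) - ramp (n * 0 - real (\<iota> i))) {0..1}"
    using coordinate_derivative
    by (intro fundamental_theorem_of_calculus_interior_strong[OF finite_S] continuous_coordinate)
       (auto simp: has_real_derivative_iff_has_vector_derivative)
  then show "speed i integrable_on {0..1}" by blast
  show "0 \<le> speed i t" for t
    using n_pos by (auto simp: speed_def ramp_slope_def sgn_if)
qed

lemma signature_path_axis_path: "signature_path (axis_path \<iota>)"
  unfolding signature_path_def
proof
  have "continuous_on {0..1} (axis_path \<iota>)"
    unfolding axis_path_def[abs_def] n_def[symmetric] by (intro continuous_intros continuous_coordinate)
  moreover have "axis_path \<iota> C1_differentiable_on ({0..1} - S)"
    unfolding C1_differentiable_on_def
  proof (intro exI conjI ballI)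
    show "(axis_path \<iota> has_vector_derivative (\<Sum>i\<in>UNIV. speed i t *\<^sub>R axis i 1)) (at t)"
      if "t \<in> {0..1} - S" for t
      using that by (intro axis_path_derivative) auto
    show "continuous_on ({0..1} - S) (\<lambda>t. \<Sum>i\<in>UNIV. speed i t *\<^sub>R axis i (1 :: complex))"
      by (intro continuous_intros continuous_speed)
  qed
  ultimately show "axis_path \<iota> piecewise_C1_differentiable_on {0..1}"
    unfolding piecewise_C1_differentiable_on_def using finite_S by blast
  have "(\<lambda>t. \<Sum>i\<in>UNIV. speed i t *\<^sub>R axis i (1 :: complex)) absolutely_integrable_on {0..1}"
  proof (rule absolutely_integrable_sum)
    fix i :: 'm
    have "(\<lambda>r. r *\<^sub>R axis i (1 :: complex)) \<circ> speed i absolutely_integrable_on {0..1}"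
      by (intro absolutely_integrable_linear speed_absolutely_integrable bounded_linear_scaleR_left)
    then show "(\<lambda>t. speed i t *\<^sub>R axis i (1 :: complex)) absolutely_integrable_on {0..1}"
      by (simp add: o_def)
  qed simp
  then show "(\<lambda>t. vector_derivative (axis_path \<iota>) (at t)) absolutely_integrable_on {0..1}"
    by (rule absolutely_integrable_spike[OF _ negligible_finite[OF finite_S]])
       (auto intro: vector_derivative_at axis_path_derivative)
qed

section \<open>Iterated integrals of the axis path\<close>

private abbreviation "v \<equiv> velocity (axis_path \<iota>)"

private definition e :: "'m \<Rightarrow> real \<Rightarrow> complex"
  where "e i t = of_real (ramp (n * t - real (\<iota> i)))"

private lemma e_derivative: "t \<notin> S \<Longrightarrow> (e i has_vector_derivative v i t) (at t)"
  unfolding e_def[abs_def]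
  by (simp add: velocity_axis_path coordinate_derivative has_vector_derivative_of_real
      flip: has_real_derivative_iff_has_vector_derivative)

private lemma e_continuous: "continuous_on A (e i)"
  unfolding e_def[abs_def] by (intro continuous_intros continuous_coordinate)

private lemma e_0: "e i 0 = 0"
  by (simp add: e_def ramp_simps)

private lemma e_1: "e i 1 = 1"
proof -
  have "1 \<le> n - real (\<iota> i)" using index_less[OF \<iota>, of i] by (simp add: n_def)
  then show ?thesis by (simp add: e_def ramp_simps)
qed

text \<open>The coordinates move one after the other: coordinate i has already reached 1 whenever
  the later coordinate j moves.\<close>

private lemma e_v_less:
  assumes "\<iota> i < \<iota> j" "t \<notin> S"
  shows "e i t * v j t = v j t"
proof (cases "n * t - real (\<iota> j) < 0")
  case False
  then have "1 \<le> n * t - real (\<iota> i)" using assms(1) by simp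
  then show ?thesis by (simp add: e_def ramp_simps)
qed (simp add: velocity_axis_path[OF assms(2)] speed_def ramp_slope_simps)

text \<open>Coordinate i is still 0 whenever the earlier coordinate j moves.\<close>

private lemma e_v_greater:
  assumes "\<iota> j < \<iota> i" "t \<notin> S"
  shows "e i t * v j t = 0"
proof (cases "1 < n * t - real (\<iota> j)")
  case False
  then have "n * t - real (\<iota> i) \<le> 0" using assms(1) by simp
  then show ?thesis by (simp add: e_def ramp_simps)
qed (simp add: velocity_axis_path[OF assms(2)] speed_def ramp_slope_simps)

private lemma primitive_v: "t \<in> {0..1} \<Longrightarrow> primitive (v i) t = e i t"
  by (rule primitive_eqI[OF finite_S e_continuous e_0]) (auto intro: e_derivative)

private lemma primitive_e_v:
  assumes "t \<in> {0..1}"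
  shows "primitive (\<lambda>t. e i t * v j t) t =
    (if \<iota> i < \<iota> j then e j t else if \<iota> i = \<iota> j then e i t * e i t / 2 else 0)"
proof -
  consider "\<iota> i < \<iota> j" | "i = j" | "\<iota> j < \<iota> i"
    using \<iota> by (metis bij_betw_def inj_eq linorder_less_linear)
  then show ?thesis
  proof cases
    case 1
    have "primitive (\<lambda>t. e i t * v j t) t = e j t"
      using assms by (intro primitive_eqI[OF finite_S e_continuous e_0]) (auto simp: e_v_less 1 e_derivative)
    with 1 show ?thesis by simp
  next
    case 2
    have "primitive (\<lambda>t. e j t * v j t) t = e j t * e j t / 2"
    proof (rule primitive_eqI[OF finite_S _ _ _ assms])
      show "((\<lambda>t. e j t * e j t / 2) has_vector_derivative e j x * v j x) (at x)" if "x \<in> {0<..<1} - S" for x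
        using has_vector_derivative_divide[OF has_vector_derivative_mult[OF e_derivative e_derivative], of x j j 2] that
        by (simp add: mult.commute)
    qed (auto intro!: continuous_intros e_continuous simp: e_0)
    with 2 show ?thesis by simp
  next
    case 3
    have "primitive (\<lambda>t. e i t * v j t) t = 0"
      using assms by (intro primitive_eqI[OF finite_S, where E = "\<lambda>_. 0"]) (auto simp: e_v_greater 3)
    with 3 show ?thesis by simp
  qed
qed

text \<open>This treats the third letter after a repeated pair, whose double integral is e_i^2 / 2.
  A third repetition has antiderivative e_i^3 / 6.\<close>

private lemma primitive_e_e_v:
  "primitive (\<lambda>t. e i t * e i t / 2 * v j t) 1 =
    (if \<iota> i < \<iota> j then 1 / 2 else if \<iota> i = \<iota> j then 1 / 6 else 0)"
proof -
  consider "\<iota> i < \<iota> j" | "i = j" | "\<iota> j < \<iota> i"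
    using \<iota> by (metis bij_betw_def inj_eq linorder_less_linear)
  then show ?thesis
  proof cases
    case 1
    have eq: "e i x * e i x / 2 * v j x = v j x / 2" if "x \<notin> S" for x
    proof -
      have "e i x * e i x / 2 * v j x = e i x * (e i x * v j x) / 2" by simp
      then show ?thesis by (simp only: e_v_less[OF 1 that])
    qed
    have "primitive (\<lambda>t. e i t * e i t / 2 * v j t) 1 = e j 1 / 2"
    proof (rule primitive_eqI[OF finite_S])
      show "((\<lambda>t. e j t / 2) has_vector_derivative e i x * e i x / 2 * v j x) (at x)" if "x \<in> {0<..<1} - S" for x
      proof -
        have x: "x \<notin> S" using that by simp
        show ?thesis
          unfolding eq[OF x] by (rule has_vector_derivative_divide[OF e_derivative[OF x]])
      qed
    qed (auto intro!: continuous_intros e_continuous simp: e_0)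
    with 1 show ?thesis by (simp add: e_1)
  next
    case 2
    have "primitive (\<lambda>t. e j t * e j t / 2 * v j t) 1 = e j 1 * e j 1 * e j 1 / 6"
    proof (rule primitive_eqI[OF finite_S])
      show "((\<lambda>t. e j t * e j t * e j t / 6) has_vector_derivative e j x * e j x / 2 * v j x) (at x)"
        if "x \<in> {0<..<1} - S" for x
        using has_vector_derivative_divide[OF has_vector_derivative_mult[OF
              has_vector_derivative_mult[OF e_derivative e_derivative] e_derivative], of x j j j 6] that
        by (simp add: algebra_simps)
    qed (auto intro!: continuous_intros e_continuous simp: e_0)
    with 2 show ?thesis by (simp add: e_1)
  next
    case 3
    have eq: "e i x * e i x / 2 * v j x = 0" if "x \<notin> S" for x
      using e_v_greater[OF 3 that] by simp
    have "primitive (\<lambda>t. e i t * e i t / 2 * v j t) 1 = 0"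
      by (intro primitive_eqI[OF finite_S, where E = "\<lambda>_. 0"]) (auto simp: eq simp del: times_divide_eq_left)
    with 3 show ?thesis by simp
  qed
qed

lemma signature3_axis_path: "signature3 (axis_path \<iota>) = axis_tensor \<iota>"
proof -
  have "signature3 (axis_path \<iota>) $ i $ j $ k = axis_tensor \<iota> $ i $ j $ k" for i j k
  proof -
    define E where "E t = (if \<iota> i < \<iota> j then e j t else if \<iota> i = \<iota> j then e i t * e i t / 2 else 0)" for t
    have inner: "primitive (\<lambda>t. primitive (v i) t * v j t) t = E t" if "t \<in> {0..1}" for t
    proof -
      have "primitive (\<lambda>t. primitive (v i) t * v j t) t = primitive (\<lambda>t. e i t * v j t) t"
        using that by (intro primitive_cong) (auto simp: primitive_v)
      then show ?thesis by (simp add: primitive_e_v[OF that] E_def)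
    qed
    have "signature3 (axis_path \<iota>) $ i $ j $ k = primitive (\<lambda>t. E t * v k t) 1"
      unfolding signature3_entry by (intro primitive_cong) (auto simp: inner)
    also have "\<dots> = axis_tensor \<iota> $ i $ j $ k"
    proof -
      consider "\<iota> i < \<iota> j" | "\<iota> i = \<iota> j" | "\<iota> j < \<iota> i" by linarith
      then show ?thesis
      proof cases
        case 1
        then show ?thesis by (simp add: E_def axis_tensor_entry primitive_e_v e_1)
      next
        case 2
        then show ?thesis using primitive_e_e_v[of i k] by (simp add: E_def axis_tensor_entry)
      next
        case 3
        then show ?thesis by (simp add: E_def axis_tensor_entry primitive_def)
      qed
    qed
    finally show ?thesis .
  qed
  then show ?thesis by (simp add: vec_eq_iff)
qed

end

section \<open>The exceptional set and generic uniqueness\<close>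

theorem corollary5p3:
  assumes "CARD('m::finite) \<le> CARD('d::finite)"
  shows "\<exists>Z :: (complex, 'm) tensor3 set.
    zariski_closed Z \<and> Z \<subset> universal_variety \<and>
    (\<forall>C :: (real, 'm) tensor3. complex_tensor C \<in> universal_variety - Z \<longrightarrow>
      (\<forall>X :: real ^ 'm ^ 'd. rank X = CARD('m) \<longrightarrow>
        (\<forall>Y :: real ^ 'm ^ 'd. \<lbrakk>C; X, X, X\<rbrakk> = \<lbrakk>C; Y, Y, Y\<rbrakk> \<longleftrightarrow> Y = X)))"
proof -
  obtain \<iota> :: "'m \<Rightarrow> nat" where \<iota>: "bij_betw \<iota> UNIV {..<CARD('m)}"
    using ex_bij_betw_finite_nat[of "UNIV :: 'm set"] by (auto simp: atLeast0LessThan)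
  \<comment> \<open>Any index will do, since the axis path has P_a = 1 for every
    \<open>a\<close>.\<close>
  fix a :: 'm
  define Z where "Z = universal_variety \<inter> {T. genericity \<iota> a T = 0}"
  have "zariski_closed Z"
    unfolding Z_def using zariski_closed_universal_variety
      zariski_closed_zeros[OF tensor_polynomial_genericity, of \<iota> a]
      zariski_closed_Inter[of "{universal_variety, {T. genericity \<iota> a T = 0}}"] by auto
  \<comment> \<open>The axis tensor is a point of the variety where the genericity polynomial is
    nonzero, so \<open>Z\<close> is a proper subset.\<close>
  moreover have "axis_tensor \<iota> \<in> universal_variety"
    using signature_path_axis_path[OF \<iota>] unfolding universal_variety_def signature3_axis_path[OF \<iota>, symmetric]
    by (intro hull_inc) blast
  then have "Z \<subset> universal_variety"
    using genericity_axis[OF \<iota>, of a] by (auto simp: Z_def)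
  moreover have "Y = X"
    if "complex_tensor C \<in> universal_variety - Z" "rank X = CARD('m)" "\<lbrakk>C; X, X, X\<rbrakk> = \<lbrakk>C; Y, Y, Y\<rbrakk>"
    for C :: "(real, 'm) tensor3" and X Y :: "real ^ 'm ^ 'd"
    using _ that(2,3)
  proof (rule unique_recovery)
    show "h = mat 1" if "\<lbrakk>C; h, h, h\<rbrakk> = C" for h :: "real ^ 'm ^ 'm"
      using \<open>complex_tensor C \<in> universal_variety - Z\<close> that
      by (intro stabilizer_trivial_on_universal_variety[of C \<iota> a]) (auto simp: Z_def)
  qed
  ultimately show ?thesis by (intro exI[of _ Z]) auto
qed

end
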